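(* Let $G$ be a finite soluble group and let $\sigma, \tau, \upsilon$ be three (pairwise distinct) subsets of $\pi(G)$ such that $\sigma \cup \tau = \tau \cup \upsilon = \upsilon \cup \sigma = \pi(G)$. Then $$h(G) \leq h(G_{\sigma}) + h(G_{\tau}) + h(G_{\upsilon}) - 2.$$ In particular, if $p, q \in \pi(G)$ and $p \neq q$, then $$h(G) \leq h(G_{p'}) + h(G_{q'}) + h(G_{\{p,q\}}) - 2.$$
   Context: For a finite soluble group $G$: $\pi(G)$ is the set of prime divisors of $|G|$; $h(G)$ is the Fitting length (nilpotent length) of $G$, with $h(1)=0$. For a set of primes $\sigma$, $G_{\sigma}$ denotes a Hall $\sigma$-subgroup of $G$ (a subgroup whose order is divisible only by primes in $\sigma$ and whose index is divisible by no prime in $\sigma$; it is unique up to conjugacy, so $h(G_\sigma)$ is well defined). For a prime $p$, $G_{p'}$ denotes $G_{\pi(G)\setminus\{p\}}$. *)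

theory Defs
  imports "HOL-Algebra.Solvable_Groups" "HOL-Computational_Algebra.Primes"
begin

definition commutator_subgroup :: "('a, 'b) monoid_scheme \<Rightarrow> 'a set \<Rightarrow> 'a set \<Rightarrow> 'a set" where
  "commutator_subgroup G H K =
     generate G {h \<otimes>\<^bsub>G\<^esub> k \<otimes>\<^bsub>G\<^esub> inv\<^bsub>G\<^esub> h \<otimes>\<^bsub>G\<^esub> inv\<^bsub>G\<^esub> k | h k. h \<in> H \<and> k \<in> K}"

primrec lower_central_series :: "('a, 'b) monoid_scheme \<Rightarrow> nat \<Rightarrow> 'a set" where
  "lower_central_series G 0 = carrier G"
| "lower_central_series G (Suc n) =
     commutator_subgroup G (lower_central_series G n) (carrier G)"

definition nilpotent_group :: "('a, 'b) monoid_scheme \<Rightarrow> bool" where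
  "nilpotent_group G \<longleftrightarrow> group G \<and> (\<exists>n. lower_central_series G n = {\<one>\<^bsub>G\<^esub>})"

definition fitting_subgroup :: "('a, 'b) monoid_scheme \<Rightarrow> 'a set" where
  "fitting_subgroup G =
     generate G (\<Union>{N. N \<lhd> G \<and> nilpotent_group (G\<lparr>carrier := N\<rparr>)})"

text \<open>The next term of the series is the full preimage in \<open>G\<close> of the Fitting subgroup of the
  quotient by the current term.\<close>

primrec fitting_series :: "('a, 'b) monoid_scheme \<Rightarrow> nat \<Rightarrow> 'a set" where
  "fitting_series G 0 = {\<one>\<^bsub>G\<^esub>}"
| "fitting_series G (Suc n) =
     {x \<in> carrier G. fitting_series G n #>\<^bsub>G\<^esub> x \<in> fitting_subgroup (G Mod fitting_series G n)}"

text \<open>Only meaningful if the Fitting series reaches \<open>G\<close>, as it does for every finite soluble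
  group; otherwise the \<open>LEAST\<close> is unspecified.\<close>

definition fitting_length :: "('a, 'b) monoid_scheme \<Rightarrow> nat" where
  "fitting_length G = (LEAST n. fitting_series G n = carrier G)"

definition prime_divisors_of_order :: "('a, 'b) monoid_scheme \<Rightarrow> nat set" where
  "prime_divisors_of_order G = {p. prime p \<and> p dvd order G}"

definition hall_subgroup :: "('a, 'b) monoid_scheme \<Rightarrow> nat set \<Rightarrow> 'a set \<Rightarrow> bool" where
  "hall_subgroup G \<sigma> H \<longleftrightarrow>
     subgroup H G \<and>
     (\<forall>p. prime p \<and> p dvd card H \<longrightarrow> p \<in> \<sigma>) \<and>
     (\<forall>p. prime p \<and> p \<in> \<sigma> \<longrightarrow> \<not> p dvd card (rcosets\<^bsub>G\<^esub> H))"

lemma fitting_length_trivial: "carrier G = {\<one>\<^bsub>G\<^esub>} \<Longrightarrow> fitting_length G = 0"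
  by (simp add: fitting_length_def)

end

theory Submission
  imports Defs "HOL-Algebra.SndIsomorphismGrp" "HOL-Algebra.Sylow" "HOL-Algebra.Zassenhaus"
begin

text \<open>Every finite soluble group \<open>G\<close> of Fitting length \<open>h\<close> carries a word
\<open>p\<^sub>1 \<dots> p\<^sub>h\<close> of primes, neighbouring letters being distinct, with this property:
delete from the word the letters outside a set \<open>\<sigma>\<close> and count the runs of equal letters
in what is left; if a letter is left, a Hall \<open>\<sigma>\<close>-subgroup of \<open>G\<close> has at least that
Fitting length (\<open>prime_word_exists\<close>).  The bound is then a count.  The complements of
\<open>\<sigma>\<close>, \<open>\<tau>\<close> and \<open>\<upsilon>\<close> in \<open>\<pi>(G)\<close> are pairwise disjoint, so each letter is deleted for at most
one of the three sets, and each of the \<open>h - 1\<close> neighbouring pairs survives for at least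
one of them and contributes a change of run there.  Hence \<open>h - 1\<close> is at most the sum of
the three numbers of runs, each diminished by one (\<open>length_le_sum_runs\<close>).

The word is found by refining the Fitting length to a length at each prime \<open>r\<close>: one plus
the Fitting length of the quotient by \<open>O\<^bsub>r'r\<^esub>\<close>.  A group is nilpotent if and only if it has a
normal \<open>r\<close>-complement for every prime \<open>r\<close>, so the Fitting length is the maximum of these
lengths; and if \<open>O\<^sub>p\<close> is trivial, the maximum is attained at a prime other than \<open>p\<close>
(\<open>height_le_from_primes\<close>).  Let \<open>q\<close> be a prime at which the length of \<open>G\<close> is attained.
Then \<open>q\<close> is the first letter.  The quotient \<open>G / O\<^bsub>q'q\<^esub>(G)\<close> has Fitting length one less and
trivial \<open>O\<^sub>q\<close>, so it provides the other letters, the next of which is not \<open>q\<close>.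

A Hall \<open>\<sigma>\<close>-subgroup \<open>S\<close> with \<open>q \<in> \<sigma>\<close> covers the \<open>q\<close>-layer \<open>O\<^bsub>q'q\<^esub>/O\<^bsub>q'\<^esub>\<close>.  By the soluble case
of the Hall-Higman lemma this layer contains its own centralizer in \<open>G/O\<^bsub>q'\<^esub>\<close>
(\<open>hall_higman\<close>); hence the normal \<open>q'\<close>-subgroups of \<open>S\<close> lie inside \<open>O\<^bsub>q'q\<^esub>\<close>, and the
length of \<open>S\<close> at \<open>q\<close> exceeds by at least one the length of its image in \<open>G / O\<^bsub>q'q\<^esub>\<close> at any
prime \<open>r \<noteq> q\<close> dividing the order of that image (\<open>prime_height_le_strip_primary\<close>).

A quotient \<open>G / K\<close> is represented by the group \<open>G\<close> together with its normal subgroup \<open>K\<close>,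
and a section by a pair of nested subgroups.  All inductions along quotients thereby stay
inside one group, and most facts about sections reduce to divisibility of indices.\<close>

section \<open>Indices of sections and sets of primes\<close>

text \<open>For nested subgroups \<open>K \<subseteq> L\<close> this says that \<open>|L : K|\<close> is a \<open>\<pi>\<close>-number, so that \<open>L / K\<close> is
a \<open>\<pi>\<close>-group when \<open>K\<close> is normal.  No group occurs in the definition: the same fact serves for
a group and for its subgroups.  The two cases that matter are \<open>{r}\<close> and \<open>- {r}\<close>, the
\<open>r\<close>-sections and the \<open>r'\<close>-sections.\<close>

definition pi_section :: "nat set \<Rightarrow> 'a set \<Rightarrow> 'a set \<Rightarrow> bool" where
  "pi_section \<pi> K L \<longleftrightarrow> (\<forall>q. prime q \<longrightarrow> q dvd card L div card K \<longrightarrow> q \<in> \<pi>)"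

locale finite_group = group +
  assumes finite_carrier: "finite (carrier G)"

lemma (in group) subgroup_card_dvd:
  assumes "subgroup K G" "subgroup L G" "K \<subseteq> L"
  shows "card K dvd card L"
proof -
  interpret L: group "G\<lparr>carrier := L\<rparr>" using assms(2) by (rule subgroup_imp_group)
  have "subgroup K (G\<lparr>carrier := L\<rparr>)" using assms subgroup_incl by blast
  from L.lagrange[OF this] have "card (rcosets\<^bsub>G\<lparr>carrier := L\<rparr>\<^esub> K) * card K = card L"
    by (simp add: order_def)
  then show ?thesis by (metis dvd_triv_right)
qed

context finite_group
begin

lemma finite_subgroup: "subgroup H G \<Longrightarrow> finite H"
  using finite_carrier subgroup.subset finite_subset by blast

lemma card_pos: "subgroup H G \<Longrightarrow> card H > 0"
  using finite_subgroup subgroup.one_closed by (metis card_gt_0_iff empty_iff)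

lemma finite_group_restrict: "subgroup H G \<Longrightarrow> finite_group (G\<lparr>carrier := H\<rparr>)"
  by (simp add: finite_group_def finite_group_axioms_def subgroup_imp_group finite_subgroup)

lemma mult_subgroup: "N \<lhd> G \<Longrightarrow> subgroup H G \<Longrightarrow> subgroup (N <#> H) G"
  by (rule mult_norm_subgroup)

lemma subset_mult_left:
  assumes "subgroup N G" "subgroup H G" shows "N \<subseteq> N <#> H"
proof
  fix x assume "x \<in> N"
  then have "x = x \<otimes> \<one>" using subgroup.mem_carrier[OF assms(1)] by simp
  then show "x \<in> N <#> H"
    unfolding set_mult_def using \<open>x \<in> N\<close> subgroup.one_closed[OF assms(2)] by blast
qed

lemma subset_mult_right:
  assumes "subgroup N G" "subgroup H G" shows "H \<subseteq> N <#> H"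
proof
  fix x assume "x \<in> H"
  then have "x = \<one> \<otimes> x" using subgroup.mem_carrier[OF assms(2)] by simp
  then show "x \<in> N <#> H"
    unfolding set_mult_def using \<open>x \<in> H\<close> subgroup.one_closed[OF assms(1)] by blast
qed

lemma mult_least: "subgroup X G \<Longrightarrow> N \<subseteq> X \<Longrightarrow> H \<subseteq> X \<Longrightarrow> N <#> H \<subseteq> X"
  unfolding set_mult_def using subgroup.m_closed by fastforce

lemma mult_absorb: "subgroup N G \<Longrightarrow> subgroup H G \<Longrightarrow> N \<subseteq> H \<Longrightarrow> N <#> H = H"
  using mult_least[of H N H] subset_mult_right by blast

text \<open>The order form of the second isomorphism theorem.\<close>

lemma card_mult_Int:
  assumes "N \<lhd> G" "subgroup H G"
  shows "card (N <#> H) * card (N \<inter> H) = card N * card H"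
proof -
  interpret second_isomorphism_grp N G H
    using assms by (simp add: second_isomorphism_grp_def second_isomorphism_grp_axioms_def)
  have sN: "subgroup N G" using assms normal_imp_subgroup by blast
  let ?A = "G\<lparr>carrier := N <#> H\<rparr>" and ?B = "G\<lparr>carrier := H\<rparr>"
  have sA: "subgroup (N <#> H) G" using assms by (rule mult_subgroup)
  interpret A: group ?A using sA by (rule subgroup_imp_group)
  interpret B: group ?B using assms(2) by (rule subgroup_imp_group)
  have e1: "card (carrier (?B Mod (N \<inter> H))) = card (carrier (?A Mod N))"
    using normal_intersection_quotient_isom iso_same_card is_isoI by blast
  have e2: "card (carrier (?A Mod N)) * card N = card (N <#> H)"
    using A.lagrange[of N] subgroup_incl[OF sN sA subset_mult_left[OF sN assms(2)]]
    unfolding order_def FactGroup_def by simp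
  have "subgroup (N \<inter> H) ?B"
    using subgroup_incl[OF _ assms(2)] subgroups_Inter_pair[OF sN assms(2)] by simp
  then have e3: "card (carrier (?B Mod (N \<inter> H))) * card (N \<inter> H) = card H"
    using B.lagrange[of "N \<inter> H"] unfolding order_def FactGroup_def by simp
  show ?thesis unfolding e2[symmetric] e3[symmetric] e1 by (simp only: ac_simps)
qed

lemma index_mult:
  assumes "N \<lhd> G" "subgroup H G"
  shows "card (N <#> H) div card N = card H div card (N \<inter> H)"
    and "card (N <#> H) div card H = card N div card (N \<inter> H)"
proof -
  have sN: "subgroup N G" using assms normal_imp_subgroup by blast
  have sI: "subgroup (N \<inter> H) G" using subgroups_Inter_pair[OF sN assms(2)] .
  obtain a where a: "card H = card (N \<inter> H) * a" using subgroup_card_dvd[OF sI assms(2)] by auto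
  obtain b where b: "card N = card (N \<inter> H) * b" using subgroup_card_dvd[OF sI sN] by auto
  have p: "card (N \<inter> H) > 0" "card H > 0" "card N > 0" using card_pos sI sN assms by auto
  have e: "card (N <#> H) * card (N \<inter> H) = card N * card H" using card_mult_Int[OF assms] .
  have "card (N <#> H) * card (N \<inter> H) = (card N * a) * card (N \<inter> H)"
    unfolding e a by (simp only: ac_simps)
  then have "card (N <#> H) = card N * a" using p(1) by simp
  moreover have "card (N <#> H) * card (N \<inter> H) = (card H * b) * card (N \<inter> H)"
    unfolding e b by (simp only: ac_simps)
  then have "card (N <#> H) = card H * b" using p(1) by simp
  moreover have "card H div card (N \<inter> H) = a" "card N div card (N \<inter> H) = b"
    using p(1) by (subst a b, simp)+
  ultimately show "card (N <#> H) div card N = card H div card (N \<inter> H)"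
    "card (N <#> H) div card H = card N div card (N \<inter> H)" using p by (metis nonzero_mult_div_cancel_left less_numeral_extra(3))+
qed

lemma index_trans:
  assumes "subgroup K G" "subgroup L G" "subgroup M G" "K \<subseteq> L" "L \<subseteq> M"
  shows "card M div card K = (card M div card L) * (card L div card K)"
proof -
  obtain a where a: "card L = card K * a" using subgroup_card_dvd assms by blast
  obtain b where b: "card M = card L * b" using subgroup_card_dvd assms by blast
  have "card K > 0" "card L > 0" using card_pos assms by auto
  then have "card L div card K = a" "card M div card L = b" "card M div card K = b * a"
    unfolding b unfolding a by simp_all
  then show ?thesis by simp
qed

lemma pi_section_trans:
  assumes "subgroup K G" "subgroup L G" "subgroup M G" "K \<subseteq> L" "L \<subseteq> M"
  shows "pi_section \<pi> K M \<longleftrightarrow> pi_section \<pi> K L \<and> pi_section \<pi> L M"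
  unfolding pi_section_def index_trans[OF assms] by (auto simp: prime_dvd_mult_iff)

lemma pi_section_refl: "subgroup K G \<Longrightarrow> pi_section \<pi> K K"
  unfolding pi_section_def using card_pos[of K] by auto

lemma pi_section_mono: "pi_section \<pi> K L \<Longrightarrow> \<pi> \<subseteq> \<rho> \<Longrightarrow> pi_section \<rho> K L"
  unfolding pi_section_def by auto

lemma pi_section_both:
  "pi_section \<pi> K L \<Longrightarrow> pi_section \<rho> K L \<Longrightarrow> pi_section (\<pi> \<inter> \<rho>) K L"
  unfolding pi_section_def by auto

lemma pi_section_empty:
  assumes "subgroup K G" "subgroup L G" "K \<subseteq> L" "pi_section {} K L"
  shows "K = L"
proof -
  have "\<not> (\<exists>q. prime q \<and> q dvd card L div card K)" using assms(4) unfolding pi_section_def by auto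
  then have "card L div card K = 1" using prime_factor_nat by blast
  moreover have "card K dvd card L" using subgroup_card_dvd assms by blast
  ultimately have "card L = card K" by (metis dvd_div_mult_self mult_1)
  then show ?thesis using assms(3) finite_subgroup[OF assms(2)] by (simp add: card_subset_eq)
qed

lemma pi_section_mult_iff:
  assumes "N \<lhd> G" "subgroup H G"
  shows "pi_section \<pi> N (N <#> H) \<longleftrightarrow> pi_section \<pi> (N \<inter> H) H"
    and "pi_section \<pi> H (N <#> H) \<longleftrightarrow> pi_section \<pi> (N \<inter> H) N"
  unfolding pi_section_def index_mult[OF assms] by auto

text \<open>\<open>(L \<inter> H) / (K \<inter> H)\<close> embeds in \<open>L / K\<close>.\<close>

lemma pi_section_Int:
  assumes "K \<lhd> G" "subgroup L G" "subgroup H G" "K \<subseteq> L" "pi_section \<pi> K L"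
  shows "pi_section \<pi> (K \<inter> H) (L \<inter> H)"
proof -
  have sK: "subgroup K G" using assms normal_imp_subgroup by blast
  have s: "subgroup (L \<inter> H) G" using subgroups_Inter_pair assms by blast
  have "K <#> (L \<inter> H) \<subseteq> L" using mult_least assms by auto
  then have "pi_section \<pi> K (K <#> (L \<inter> H))"
    using pi_section_trans[OF sK mult_subgroup[OF assms(1) s] assms(2) subset_mult_left[OF sK s]]
      assms by blast
  moreover have "K \<inter> (L \<inter> H) = K \<inter> H" using assms by auto
  ultimately show ?thesis using pi_section_mult_iff(1)[OF assms(1) s] by simp
qed

text \<open>\<open>LN / KN\<close> is a quotient of \<open>L / K\<close>.\<close>

lemma pi_section_mult:
  assumes "K \<lhd> G" "L \<lhd> G" "N \<lhd> G" "K \<subseteq> L" "pi_section \<pi> K L"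
  shows "pi_section \<pi> (K <#> N) (L <#> N)"
proof -
  note n = normal_imp_subgroup
  have KN: "K <#> N \<lhd> G" using normal_subgroup_set_mult_closed assms by blast
  have LN: "L <#> N \<lhd> G" using normal_subgroup_set_mult_closed assms by blast
  have "N \<subseteq> K <#> N" "K \<subseteq> K <#> N" using subset_mult_left subset_mult_right n assms by blast+
  then have e: "(K <#> N) <#> L = L <#> N"
  proof -
    have "L <#> N \<subseteq> (K <#> N) <#> L"
      using mult_least[of "(K <#> N) <#> L"] mult_subgroup[OF KN] subset_mult_right[OF n[OF KN]]
        subset_mult_left[OF n[OF KN]] \<open>N \<subseteq> K <#> N\<close> n[OF assms(2)] by (meson order_trans)
    moreover have "K <#> N \<subseteq> L <#> N" using assms(4) by (simp add: mono_set_mult)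
    then have "(K <#> N) <#> L \<subseteq> L <#> N"
      using mult_least[OF n[OF LN]] subset_mult_left n assms by blast
    ultimately show ?thesis by blast
  qed
  have sI: "subgroup ((K <#> N) \<inter> L) G" using subgroups_Inter_pair n KN assms by blast
  have "pi_section \<pi> ((K <#> N) \<inter> L) L"
    using pi_section_trans[OF n[OF assms(1)] sI n[OF assms(2)]] assms \<open>K \<subseteq> K <#> N\<close> by auto
  then show ?thesis using pi_section_mult_iff(1)[OF KN n[OF assms(2)]] e by simp
qed

end

section \<open>Sections with normal complements and Fitting height\<close>

text \<open>\<open>M / K\<close> is \<open>r\<close>-nilpotent and \<open>L / K\<close> is its normal \<open>r\<close>-complement.  The complement is
characteristic, so asking it to be normal in \<open>G\<close> costs nothing when \<open>M\<close> and \<open>K\<close> are, and it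
lets intersections and products of complements be formed in \<open>G\<close>.\<close>

definition complemented_section :: "('a, 'b) monoid_scheme \<Rightarrow> nat \<Rightarrow> 'a set \<Rightarrow> 'a set \<Rightarrow> bool" where
  "complemented_section G r K M \<longleftrightarrow>
     (\<exists>L. L \<lhd> G \<and> K \<subseteq> L \<and> L \<subseteq> M \<and> pi_section (- {r}) K L \<and> pi_section {r} L M)"

text \<open>Nilpotency of \<open>M / K\<close> (see \<open>nil_section_iff_lcs\<close>).  In this form it passes to intersections,
quotients and products by counting indices only.\<close>

definition nil_section :: "('a, 'b) monoid_scheme \<Rightarrow> 'a set \<Rightarrow> 'a set \<Rightarrow> bool" where
  "nil_section G K M \<longleftrightarrow> (\<forall>r. prime r \<longrightarrow> complemented_section G r K M)"

text \<open>The Fitting length of \<open>G / K\<close> is at most \<open>n\<close>, witnessed by a normal series with nilpotent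
factors.\<close>

primrec height_le :: "('a, 'b) monoid_scheme \<Rightarrow> nat \<Rightarrow> 'a set \<Rightarrow> bool" where
  "height_le G 0 K \<longleftrightarrow> K = carrier G"
| "height_le G (Suc n) K \<longleftrightarrow>
     (\<exists>M. M \<lhd> G \<and> K \<subseteq> M \<and> nil_section G K M \<and> height_le G n M)"

text \<open>The length of \<open>G / K\<close> at the prime \<open>r\<close>: it is \<open>0\<close> if \<open>r\<close> does not divide \<open>|G : K|\<close>, and
otherwise one more than the Fitting length of the quotient of \<open>G / K\<close> by its largest normal
\<open>r\<close>-nilpotent subgroup \<open>O\<^bsub>r'r\<^esub>(G / K)\<close>.\<close>

primrec prime_height_le :: "('a, 'b) monoid_scheme \<Rightarrow> nat \<Rightarrow> nat \<Rightarrow> 'a set \<Rightarrow> bool" where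
  "prime_height_le G r 0 K \<longleftrightarrow> pi_section (- {r}) K (carrier G)"
| "prime_height_le G r (Suc n) K \<longleftrightarrow>
     (\<exists>M. M \<lhd> G \<and> K \<subseteq> M \<and> complemented_section G r K M \<and> height_le G n M)"

context finite_group
begin

lemmas normal_mult = normal_subgroup_set_mult_closed
lemmas subset_mult_left_normal = subset_mult_left[OF normal_imp_subgroup normal_imp_subgroup]
lemmas subset_mult_right_normal = subset_mult_right[OF normal_imp_subgroup normal_imp_subgroup]
lemmas mult_absorb_normal = mult_absorb[OF normal_imp_subgroup normal_imp_subgroup]
lemmas pi_section_refl_normal = pi_section_refl[OF normal_imp_subgroup]
lemmas pi_section_trans_normal =
  pi_section_trans[OF normal_imp_subgroup normal_imp_subgroup normal_imp_subgroup]

lemma normal_Int: "M \<lhd> G \<Longrightarrow> N \<lhd> G \<Longrightarrow> M \<inter> N \<lhd> G"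
  by (rule normal_subgroup_intersect)

lemma normal_subset_carrier: "M \<lhd> G \<Longrightarrow> M \<subseteq> carrier G"
  using normal_imp_subgroup subgroup.subset by blast

lemma pi_section_Int2:
  assumes "K1 \<lhd> G" "L1 \<lhd> G" "K2 \<lhd> G" "L2 \<lhd> G" "K1 \<subseteq> L1" "K2 \<subseteq> L2"
    and "pi_section \<pi> K1 L1" "pi_section \<pi> K2 L2"
  shows "pi_section \<pi> (K1 \<inter> K2) (L1 \<inter> L2)"
proof -
  note n = normal_imp_subgroup normal_Int assms
  have "pi_section \<pi> (K1 \<inter> K2) (L1 \<inter> K2)"
    using pi_section_Int[OF assms(1) normal_imp_subgroup[OF assms(2)] normal_imp_subgroup[OF assms(3)]] assms by blast
  moreover have "pi_section \<pi> (K2 \<inter> L1) (L2 \<inter> L1)"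
    using pi_section_Int[OF assms(3) normal_imp_subgroup[OF assms(4)] normal_imp_subgroup[OF assms(2)]] assms by blast
  moreover have "subgroup (K1 \<inter> K2) G" "subgroup (L1 \<inter> K2) G" "subgroup (L1 \<inter> L2) G"
    by (auto intro: n)
  ultimately show ?thesis using pi_section_trans[of "K1 \<inter> K2" "L1 \<inter> K2" "L1 \<inter> L2"] assms
    by (auto simp: Int_commute)
qed

lemma pi_section_mult2:
  assumes "K \<lhd> G" "L1 \<lhd> G" "L2 \<lhd> G" "K \<subseteq> L1" "K \<subseteq> L2" "pi_section \<pi> K L1" "pi_section \<pi> K L2"
  shows "pi_section \<pi> K (L1 <#> L2)"
proof -
  have "pi_section \<pi> (K <#> L1) (L2 <#> L1)" using pi_section_mult assms by blast
  moreover have "K <#> L1 = L1" using mult_absorb assms normal_imp_subgroup by blast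
  moreover have "L2 <#> L1 = L1 <#> L2"
    using commut_normal[OF normal_imp_subgroup] assms by metis
  ultimately have "pi_section \<pi> L1 (L1 <#> L2)" by simp
  then show ?thesis
    using pi_section_trans[of K L1 "L1 <#> L2"] assms normal_imp_subgroup normal_mult subset_mult_left by metis
qed

lemma complemented_section_refl: "K \<lhd> G \<Longrightarrow> complemented_section G r K K"
  unfolding complemented_section_def using pi_section_refl normal_imp_subgroup by blast

lemma complemented_section_Int:
  assumes "K1 \<lhd> G" "M1 \<lhd> G" "K2 \<lhd> G" "M2 \<lhd> G"
    and "complemented_section G r K1 M1" "complemented_section G r K2 M2"
  shows "complemented_section G r (K1 \<inter> K2) (M1 \<inter> M2)"
proof -
  obtain L1 where L1: "L1 \<lhd> G" "K1 \<subseteq> L1" "L1 \<subseteq> M1" "pi_section (- {r}) K1 L1" "pi_section {r} L1 M1"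
    using assms unfolding complemented_section_def by auto
  obtain L2 where L2: "L2 \<lhd> G" "K2 \<subseteq> L2" "L2 \<subseteq> M2" "pi_section (- {r}) K2 L2" "pi_section {r} L2 M2"
    using assms unfolding complemented_section_def by auto
  show ?thesis unfolding complemented_section_def
    using L1 L2 assms(1-4) pi_section_Int2 normal_Int
    by (intro exI[of _ "L1 \<inter> L2"]) (auto intro!: pi_section_Int2 normal_Int)
qed

lemma complemented_section_mult:
  assumes "K \<lhd> G" "M \<lhd> G" "N \<lhd> G" "complemented_section G r K M"
  shows "complemented_section G r (K <#> N) (M <#> N)"
proof -
  obtain L where L: "L \<lhd> G" "K \<subseteq> L" "L \<subseteq> M" "pi_section (- {r}) K L" "pi_section {r} L M"
    using assms unfolding complemented_section_def by auto
  show ?thesis unfolding complemented_section_def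
    using normal_mult[OF L(1) assms(3)]
      pi_section_mult[OF assms(1) L(1) assms(3) L(2,4)] pi_section_mult[OF L(1) assms(2,3) L(3,5)]
      mono_set_mult[OF L(2) subset_refl] mono_set_mult[OF L(3) subset_refl] by blast
qed

text \<open>Fitting's theorem, one prime at a time: the product of the two normal \<open>r\<close>-complements is a
normal \<open>r\<close>-complement of the product.\<close>

lemma complemented_section_mult2:
  assumes "K \<lhd> G" "M1 \<lhd> G" "M2 \<lhd> G"
    and "complemented_section G r K M1" "complemented_section G r K M2"
  shows "complemented_section G r K (M1 <#> M2)"
proof -
  obtain L1 where L1: "L1 \<lhd> G" "K \<subseteq> L1" "L1 \<subseteq> M1" "pi_section (- {r}) K L1" "pi_section {r} L1 M1"
    using assms unfolding complemented_section_def by auto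
  obtain L2 where L2: "L2 \<lhd> G" "K \<subseteq> L2" "L2 \<subseteq> M2" "pi_section (- {r}) K L2" "pi_section {r} L2 M2"
    using assms unfolding complemented_section_def by auto
  note c = commut_normal[OF normal_imp_subgroup]
  have "pi_section {r} (L1 <#> L2) (M1 <#> L2)" using pi_section_mult L1 L2 assms by blast
  moreover have "pi_section {r} (L2 <#> M1) (M2 <#> M1)" using pi_section_mult L1 L2 assms by blast
  moreover have "L2 <#> M1 = M1 <#> L2" "M2 <#> M1 = M1 <#> M2" using c assms L2 by metis+
  moreover have "L1 <#> L2 \<subseteq> M1 <#> L2" "M1 <#> L2 \<subseteq> M1 <#> M2"
    using mono_set_mult[OF L1(3) subset_refl] mono_set_mult[OF subset_refl L2(3)] by blast+
  moreover have "subgroup (L1 <#> L2) G" "subgroup (M1 <#> L2) G" "subgroup (M1 <#> M2) G"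
    using L1 L2 assms normal_mult normal_imp_subgroup by blast+
  ultimately have "pi_section {r} (L1 <#> L2) (M1 <#> M2)"
    using pi_section_trans[of "L1 <#> L2" "M1 <#> L2" "M1 <#> M2"] by simp
  moreover have "pi_section (- {r}) K (L1 <#> L2)" using pi_section_mult2 L1 L2 assms by blast
  moreover have "K \<subseteq> L1 <#> L2" using subset_mult_left[of L1 L2] L1 L2 normal_imp_subgroup by blast
  moreover have "L1 <#> L2 \<subseteq> M1 <#> M2" by (rule mono_set_mult[OF L1(3) L2(3)])
  ultimately show ?thesis unfolding complemented_section_def using normal_mult L1 L2 by blast
qed

lemma complemented_section_extend:
  assumes "K \<lhd> G" "N \<lhd> G" "M \<lhd> G" "K \<subseteq> N" "pi_section (- {r}) K N" "complemented_section G r N M"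
  shows "complemented_section G r K M"
proof -
  obtain L where L: "L \<lhd> G" "N \<subseteq> L" "L \<subseteq> M" "pi_section (- {r}) N L" "pi_section {r} L M"
    using assms unfolding complemented_section_def by auto
  then show ?thesis unfolding complemented_section_def
    using pi_section_trans_normal[OF assms(1,2) L(1) assms(4) L(2)] assms by blast
qed

text \<open>Quotients do not have larger Fitting length: a series from \<open>K\<close> to \<open>G\<close> multiplied by \<open>N\<close> is a
series from \<open>N\<close> to \<open>G\<close>.\<close>

lemma height_le_normal_mono:
  assumes "K \<lhd> G" "N \<lhd> G" "K \<subseteq> N" "height_le G n K"
  shows "height_le G n N"
  using assms
proof (induction n arbitrary: K N)
  case 0
  then show ?case using normal_subset_carrier by auto
next
  case (Suc n)
  then obtain M where M: "M \<lhd> G" "K \<subseteq> M" "nil_section G K M" "height_le G n M" by auto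
  have "height_le G n (M <#> N)"
    using Suc.IH[OF M(1) _ _ M(4)] normal_mult[OF M(1) Suc.prems(2)] subset_mult_left_normal[OF M(1) Suc.prems(2)] Suc.prems(2) by blast
  moreover have "K <#> N = N" using mult_absorb Suc.prems normal_imp_subgroup by blast
  then have "nil_section G N (M <#> N)"
    using complemented_section_mult[OF Suc.prems(1) M(1) Suc.prems(2)] M(3) unfolding nil_section_def by auto
  ultimately show ?case
    using normal_mult[OF M(1) Suc.prems(2)] subset_mult_right_normal[OF M(1) Suc.prems(2)] by auto
qed

lemma prime_height_le_normal_mono:
  assumes "K \<lhd> G" "N \<lhd> G" "K \<subseteq> N" "prime_height_le G r n K"
  shows "prime_height_le G r n N"
proof (cases n)
  case 0
  then show ?thesis
    using assms pi_section_trans_normal[OF assms(1,2) normal_self assms(3)] normal_subset_carrier by auto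
next
  case (Suc m)
  then obtain M where M: "M \<lhd> G" "K \<subseteq> M" "complemented_section G r K M" "height_le G m M"
    using assms by auto
  have MN: "M <#> N \<lhd> G" using normal_mult assms M by blast
  have "height_le G m (M <#> N)"
    using height_le_normal_mono[OF M(1) MN _ M(4)] subset_mult_left_normal[OF M(1) assms(2)] by blast
  moreover have "K <#> N = N" using mult_absorb assms normal_imp_subgroup by blast
  then have "complemented_section G r N (M <#> N)"
    using complemented_section_mult[OF assms(1) M(1) assms(2) M(3)] by auto
  ultimately show ?thesis
    using Suc MN subset_mult_right_normal[OF M(1) assms(2)] by auto
qed

lemma height_le_Int:
  assumes "K1 \<lhd> G" "K2 \<lhd> G" "height_le G n K1" "height_le G n K2"
  shows "height_le G n (K1 \<inter> K2)"
  using assms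
proof (induction n arbitrary: K1 K2)
  case (Suc n)
  then obtain M1 where M1: "M1 \<lhd> G" "K1 \<subseteq> M1" "nil_section G K1 M1" "height_le G n M1" by auto
  from Suc.prems obtain M2 where M2: "M2 \<lhd> G" "K2 \<subseteq> M2" "nil_section G K2 M2" "height_le G n M2" by auto
  have "nil_section G (K1 \<inter> K2) (M1 \<inter> M2)"
    using complemented_section_Int[OF Suc.prems(1) M1(1) Suc.prems(2) M2(1)] M1(3) M2(3)
    unfolding nil_section_def by auto
  moreover have "K1 \<inter> K2 \<subseteq> M1 \<inter> M2" using M1(2) M2(2) by blast
  ultimately show ?case
    using Suc.IH[OF M1(1) M2(1) M1(4) M2(4)] normal_Int[OF M1(1) M2(1)] by auto
qed auto

lemma height_le_imp_prime_height_le: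
  assumes "prime r" "height_le G n K" shows "prime_height_le G r n K"
  using assms pi_section_refl[OF subgroup_self] unfolding nil_section_def
  by (cases n) (auto simp: nil_section_def)

text \<open>An \<open>r'\<close>-layer at the bottom does not affect the length at \<open>r\<close>, because it is absorbed by the
normal \<open>r\<close>-complement above it.\<close>

lemma prime_height_le_extend:
  assumes "K \<lhd> G" "N \<lhd> G" "K \<subseteq> N" "pi_section (- {r}) K N" "prime_height_le G r n N"
  shows "prime_height_le G r n K"
proof (cases n)
  case 0
  then show ?thesis
    using assms pi_section_trans_normal[OF assms(1,2) normal_self assms(3)] normal_subset_carrier by auto
next
  case (Suc m)
  then obtain M where M: "M \<lhd> G" "N \<subseteq> M" "complemented_section G r N M" "height_le G m M"
    using assms by auto
  then show ?thesis
    using complemented_section_extend[OF assms(1,2) M(1) assms(3,4) M(3)] Suc assms(3) by auto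
qed

lemma Inter_family:
  assumes "finite F" "F \<noteq> {}" "\<And>X. X \<in> F \<Longrightarrow> P X" "\<And>X Y. P X \<Longrightarrow> P Y \<Longrightarrow> P (X \<inter> Y)"
  shows "P (\<Inter>F)"
  using assms(1-3) by (induction F rule: finite_ne_induct) (auto intro: assms(4))

lemma finite_normals: "finite {N. N \<lhd> G \<and> P N}"
  by (rule finite_subset[of _ "Pow (carrier G)"]) (auto dest: normal_subset_carrier simp: finite_carrier)

lemma normal_family: "(\<And>i. i \<in> I \<Longrightarrow> N i \<lhd> G) \<Longrightarrow> finite (N ` I)"
  by (rule finite_subset[OF _ finite_normals[of "\<lambda>_. True"]]) auto

text \<open>The Fitting length is controlled by the lengths at the primes in \<open>\<pi>\<close>, provided that \<open>G / K\<close>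
has no normal \<open>\<pi>'\<close>-subgroup except \<open>1\<close>.  The sections \<open>M q / K\<close> at the bottom for the primes
\<open>q \<in> \<pi>\<close> meet in \<open>D / K\<close>.  Let \<open>X / K\<close> be the intersection of their normal complements, taken
in \<open>D\<close>.  It is a \<open>\<pi>'\<close>-group, hence trivial, and so \<open>D / K\<close> embeds in a product of \<open>q\<close>-groups
with \<open>q \<in> \<pi>\<close>.  Therefore \<open>D / K\<close> is a nilpotent \<open>\<pi>\<close>-group, while \<open>G / D\<close> has the smaller
Fitting length required.\<close>

lemma height_le_from_primes:
  assumes K: "K \<lhd> G" and ne: "\<exists>q\<in>\<pi>. prime q"
    and h: "\<And>q. q \<in> \<pi> \<Longrightarrow> prime q \<Longrightarrow> prime_height_le G q n K"
    and nt: "\<And>N. N \<lhd> G \<Longrightarrow> K \<subseteq> N \<Longrightarrow> pi_section (- \<pi>) K N \<Longrightarrow> N = K"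
  shows "height_le G n K"
proof (cases n)
  case 0
  then have "pi_section (- \<pi>) K (carrier G)"
    unfolding pi_section_def
  proof (intro allI impI)
    fix q assume q: "prime q" "q dvd card (carrier G) div card K"
    show "q \<in> - \<pi>"
    proof
      assume "q \<in> \<pi>"
      then have "pi_section (- {q}) K (carrier G)" using h q(1) 0 by simp
      then show False using q unfolding pi_section_def by auto
    qed
  qed
  then show ?thesis using nt[OF normal_self] normal_subset_carrier[OF K] 0 by auto
next
  case (Suc m)
  let ?I = "{q \<in> \<pi>. prime q}"
  have ex: "\<forall>q\<in>?I. \<exists>M L. M \<lhd> G \<and> L \<lhd> G \<and> K \<subseteq> L \<and> L \<subseteq> M \<and> pi_section (- {q}) K L \<and> pi_section {q} L M \<and> height_le G m M"
  proof
    fix q assume "q \<in> ?I"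
    then have "prime_height_le G q n K" using h by blast
    then show "\<exists>M L. M \<lhd> G \<and> L \<lhd> G \<and> K \<subseteq> L \<and> L \<subseteq> M \<and> pi_section (- {q}) K L \<and> pi_section {q} L M \<and> height_le G m M"
      unfolding Suc prime_height_le.simps complemented_section_def by blast
  qed
  from bchoice[OF ex] obtain M where ex': "\<forall>q\<in>?I. \<exists>L. M q \<lhd> G \<and> L \<lhd> G \<and> K \<subseteq> L \<and> L \<subseteq> (M q) \<and> pi_section (- {q}) K L
    \<and> pi_section {q} L (M q) \<and> height_le G m (M q)"
    by blast
  from bchoice[OF ex'] obtain L where "\<forall>q\<in>?I. M q \<lhd> G \<and> (L q) \<lhd> G \<and> K \<subseteq> (L q) \<and> (L q) \<subseteq> (M q) \<and> pi_section (- {q}) K (L q)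
    \<and> pi_section {q} (L q) (M q) \<and> height_le G m (M q)"
    by blast
  then have fam: "\<And>q. q \<in> ?I \<Longrightarrow> M q \<lhd> G" "\<And>q. q \<in> ?I \<Longrightarrow> L q \<lhd> G" "\<And>q. q \<in> ?I \<Longrightarrow> K \<subseteq> L q"
    "\<And>q. q \<in> ?I \<Longrightarrow> L q \<subseteq> M q" "\<And>q. q \<in> ?I \<Longrightarrow> pi_section (- {q}) K (L q)"
    "\<And>q. q \<in> ?I \<Longrightarrow> pi_section {q} (L q) (M q)" "\<And>q. q \<in> ?I \<Longrightarrow> height_le G m (M q)"
    by blast+
  define D where "D = \<Inter>(M ` ?I)"
  have I: "?I \<noteq> {}" using ne by auto
  have D: "D \<lhd> G \<and> height_le G m D" unfolding D_def
  proof (rule Inter_family[where P = "\<lambda>D. D \<lhd> G \<and> height_le G m D"])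
    show "finite (M ` ?I)" using fam(1) by (rule normal_family)
    show "M ` ?I \<noteq> {}" using I by blast
    show "X \<lhd> G \<and> height_le G m X" if "X \<in> M ` ?I" for X using fam(1,7) that by blast
    show "X \<inter> Y \<lhd> G \<and> height_le G m (X \<inter> Y)"
      if "X \<lhd> G \<and> height_le G m X" "Y \<lhd> G \<and> height_le G m Y" for X Y
      using height_le_Int normal_Int that by blast
  qed
  have KD: "K \<subseteq> D" and DM: "\<And>q. q \<in> ?I \<Longrightarrow> D \<subseteq> M q" using fam(3,4) unfolding D_def by blast+
  \<comment> \<open>Replacing \<open>L q\<close> by its trace on \<open>D\<close> gives normal complements of \<open>D / K\<close> itself.\<close>
  define L' where "L' q = L q \<inter> D" for q
  have L'_normal: "L' q \<lhd> G" if "q \<in> ?I" for q using normal_Int[OF fam(2)] D that unfolding L'_def by blast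
  have L'_top: "pi_section {q} (L' q) D" if "q \<in> ?I" for q
    using pi_section_Int2[OF fam(2)[OF that] fam(1)[OF that], of D D "{q}"] D fam(4,6)[OF that] DM[OF that]
      pi_section_refl_normal unfolding L'_def by (simp add: Int_absorb1)
  have L'_bottom: "pi_section (- {q}) K (L' q)" "K \<subseteq> L' q" if "q \<in> ?I" for q
    using fam(3,5)[OF that] KD pi_section_trans_normal[OF K L'_normal[OF that] fam(2)[OF that]]
    unfolding L'_def by auto
  define X where "X = \<Inter>(L' ` ?I)"
  have X: "X \<lhd> G \<and> X \<subseteq> D \<and> pi_section \<pi> X D" unfolding X_def
  proof (rule Inter_family[where P = "\<lambda>X. X \<lhd> G \<and> X \<subseteq> D \<and> pi_section \<pi> X D"])
    show "finite (L' ` ?I)" using L'_normal by (rule normal_family)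
    show "L' ` ?I \<noteq> {}" using I by blast
  next
    fix Y assume "Y \<in> L' ` ?I"
    then show "Y \<lhd> G \<and> Y \<subseteq> D \<and> pi_section \<pi> Y D"
      using L'_normal L'_top pi_section_mono[of _ _ _ \<pi>] unfolding L'_def by blast
  next
    fix Y Z assume Y: "Y \<lhd> G \<and> Y \<subseteq> D \<and> pi_section \<pi> Y D" and Z: "Z \<lhd> G \<and> Z \<subseteq> D \<and> pi_section \<pi> Z D"
    then show "Y \<inter> Z \<lhd> G \<and> Y \<inter> Z \<subseteq> D \<and> pi_section \<pi> (Y \<inter> Z) D"
      using pi_section_Int2[of Y D Z D \<pi>] D normal_Int by auto
  qed
  have "K \<subseteq> X" using L'_bottom unfolding X_def by auto
  moreover have "pi_section (- \<pi>) K X" unfolding pi_section_def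
  proof (intro allI impI)
    fix q assume q: "prime q" "q dvd card X div card K"
    show "q \<in> - \<pi>"
    proof
      assume "q \<in> \<pi>"
      then have qI: "q \<in> ?I" using q by auto
      then have "X \<subseteq> L' q" unfolding X_def by auto
      then have "pi_section (- {q}) K X"
        using pi_section_trans_normal[OF K _ L'_normal[OF qI], of X] L'_bottom[OF qI] X \<open>K \<subseteq> X\<close> by auto
      then show False using q unfolding pi_section_def by auto
    qed
  qed
  ultimately have XK: "X = K" using nt X by blast
  have "complemented_section G r K D" if r: "prime r" for r
  \<comment> \<open>For \<open>r \<notin> \<pi>\<close> the section \<open>D / K\<close> is an \<open>r'\<close>-group and is its own complement.\<close>
  proof (cases "r \<in> \<pi>")
    case True
    then show ?thesis unfolding complemented_section_def
      using L'_normal[of r] L'_top[of r] L'_bottom[of r] r by (intro exI[of _ "L' r"]) (auto simp: L'_def)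
  next
    case False
    then have "pi_section (- {r}) K D" using X XK pi_section_mono[of \<pi> K D "- {r}"] by auto
    then show ?thesis unfolding complemented_section_def
      using D KD pi_section_refl normal_imp_subgroup by blast
  qed
  then have "nil_section G K D" unfolding nil_section_def by blast
  then show ?thesis using Suc D KD by auto
qed

text \<open>The subgroup \<open>O\<^sub>\<pi>(M / K)\<close>, taken among the subgroups that are normal in \<open>G\<close>; it exists because
a product of two normal \<open>\<pi>\<close>-sections is a \<open>\<pi>\<close>-section.\<close>

lemma greatest_pi_section:
  assumes "K \<lhd> G" "K \<subseteq> M" "M \<lhd> G"
  obtains L where "L \<lhd> G" "K \<subseteq> L" "L \<subseteq> M" "pi_section \<pi> K L"
    and "\<And>N. N \<lhd> G \<Longrightarrow> K \<subseteq> N \<Longrightarrow> N \<subseteq> M \<Longrightarrow> pi_section \<pi> K N \<Longrightarrow> N \<subseteq> L"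
proof -
  let ?F = "{N. N \<lhd> G \<and> K \<subseteq> N \<and> N \<subseteq> M \<and> pi_section \<pi> K N}"
  have "K \<in> ?F" using assms pi_section_refl_normal by auto
  then obtain L where L: "L \<in> ?F" "\<And>N. N \<in> ?F \<Longrightarrow> \<not> L \<subset> N"
    using finite_has_maximal[of ?F] finite_normals[of "\<lambda>N. K \<subseteq> N \<and> N \<subseteq> M \<and> pi_section \<pi> K N"]
    by (metis (lifting) empty_iff order_less_imp_le psubset_eq)
  have "N \<subseteq> L" if N: "N \<in> ?F" for N
  proof -
    have "N \<subseteq> N <#> L" "L \<subseteq> N <#> L" using subset_mult_left_normal subset_mult_right_normal N L by auto
    moreover have "N <#> L \<subseteq> M" using mult_least[OF normal_imp_subgroup[OF assms(3)]] N L by auto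
    ultimately have "N <#> L \<in> ?F"
      using N L pi_section_mult2[OF assms(1)] normal_mult by auto
    then show ?thesis using L(2) \<open>L \<subseteq> N <#> L\<close> \<open>N \<subseteq> N <#> L\<close> by blast
  qed
  then show thesis using that[of L] L(1) by auto
qed

end

section \<open>Commutators, relative centralizers and lower central series\<close>

abbreviation (in group) comm :: "'a \<Rightarrow> 'a \<Rightarrow> 'a" where
  "comm x y \<equiv> x \<otimes> y \<otimes> inv x \<otimes> inv y"

text \<open>The lower central series of the subgroup \<open>M\<close>, computed inside the ambient group, where its
terms can be compared with the normal subgroups of that group.\<close>

primrec rel_lcs :: "('a, 'b) monoid_scheme \<Rightarrow> 'a set \<Rightarrow> nat \<Rightarrow> 'a set" where
  "rel_lcs G M 0 = M"
| "rel_lcs G M (Suc n) = commutator_subgroup G (rel_lcs G M n) M"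

text \<open>The preimage in \<open>G\<close> of the centralizer of \<open>M / L\<close> in \<open>G / L\<close>.\<close>

definition centralizer_mod :: "('a, 'b) monoid_scheme \<Rightarrow> 'a set \<Rightarrow> 'a set \<Rightarrow> 'a set" where
  "centralizer_mod G L M =
     {x \<in> carrier G. \<forall>y\<in>M. x \<otimes>\<^bsub>G\<^esub> y \<otimes>\<^bsub>G\<^esub> inv\<^bsub>G\<^esub> x \<otimes>\<^bsub>G\<^esub> inv\<^bsub>G\<^esub> y \<in> L}"

lemma (in group) inv_mult_cancel:
  "g \<in> carrier G \<Longrightarrow> w \<in> carrier G \<Longrightarrow> inv g \<otimes> (g \<otimes> w) = w"
  "g \<in> carrier G \<Longrightarrow> w \<in> carrier G \<Longrightarrow> g \<otimes> (inv g \<otimes> w) = w"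
  by (simp_all add: m_assoc[symmetric])

lemma (in group) comm_eq_one_iff:
  assumes "x \<in> carrier G" "y \<in> carrier G"
  shows "comm x y = \<one> \<longleftrightarrow> x \<otimes> y = y \<otimes> x"
proof -
  have "comm x y = (x \<otimes> y) \<otimes> inv (y \<otimes> x)" using assms by (simp add: inv_mult_group m_assoc)
  then show ?thesis using assms by (metis inv_closed inv_equality inv_inv m_closed r_inv)
qed

lemma (in group) inv_comm:
  "x \<in> carrier G \<Longrightarrow> y \<in> carrier G \<Longrightarrow> inv (comm x y) = comm y x"
  by (simp add: inv_mult_group m_assoc)

lemma (in group_hom) preimage_normal:
  assumes "N \<lhd> H" shows "{x \<in> carrier G. h x \<in> N} \<lhd> G"
proof -
  interpret N: normal N H by fact
  show ?thesis
  proof (rule G.normal_invI)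
    show "subgroup {x \<in> carrier G. h x \<in> N} G" by (rule G.subgroupI) auto
    show "x \<otimes> k \<otimes> inv x \<in> {x \<in> carrier G. h x \<in> N}"
      if "x \<in> carrier G" "k \<in> {x \<in> carrier G. h x \<in> N}" for x k
      using that N.inv_op_closed2[of "h x" "h k"] by auto
  qed
qed

lemma (in group_hom) hom_comm:
  "x \<in> carrier G \<Longrightarrow> y \<in> carrier G \<Longrightarrow> h (G.comm x y) = H.comm (h x) (h y)"
  by simp

lemma (in normal) mod_hom: "group_hom G (G Mod H) ((#>) H)"
  by (simp add: group_hom_def group_hom_axioms_def factorgroup_is_group r_coset_hom_Mod is_group)

lemma (in normal) coset_eq_iff: "x \<in> carrier G \<Longrightarrow> H #> x = H \<longleftrightarrow> x \<in> H"
  using coset_join1[of H x] coset_join2[of x H] subset is_subgroup by auto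

lemma (in group) centralizer_normal:
  assumes "N \<lhd> G"
  shows "{x \<in> carrier G. \<forall>y\<in>N. x \<otimes> y = y \<otimes> x} \<lhd> G" (is "?C \<lhd> G")
proof -
  interpret N: normal N G by fact
  have N: "y \<in> carrier G" if "y \<in> N" for y using that by auto
  have eq: "?C = {x \<in> carrier G. \<forall>y\<in>N. x \<otimes> y \<otimes> inv x = y}"
  proof (intro Collect_cong conj_cong refl ball_cong)
    fix x y assume "x \<in> carrier G" "y \<in> N"
    then show "x \<otimes> y = y \<otimes> x \<longleftrightarrow> x \<otimes> y \<otimes> inv x = y"
      using N by (simp add: inv_solve_right')
  qed
  have inv: "inv x \<otimes> y \<otimes> x = y" if "x \<in> ?C" "y \<in> N" for x y
    using that N by (simp add: m_assoc inv_solve_left')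
  show ?thesis
  proof (rule normal_invI)
    show "subgroup ?C G"
    proof (rule subgroupI)
      show "?C \<noteq> {}" using N by (auto intro!: exI[of _ \<one>])
      show "inv x \<in> ?C" if x: "x \<in> ?C" for x
        unfolding eq using x inv[OF x] by auto
      show "x \<otimes> y \<in> ?C" if x: "x \<in> ?C" "y \<in> ?C" for x y
      proof -
        have "x \<otimes> y \<otimes> z = z \<otimes> (x \<otimes> y)" if z: "z \<in> N" for z
        proof -
          have "x \<otimes> y \<otimes> z = x \<otimes> (z \<otimes> y)" using x z N by (simp add: m_assoc)
          also have "\<dots> = z \<otimes> (x \<otimes> y)" using x z N by (simp add: m_assoc[symmetric])
          finally show ?thesis .
        qed
        then show ?thesis using x by auto
      qed
    qed auto
    fix g x assume g: "g \<in> carrier G" and x: "x \<in> ?C"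
    have "(g \<otimes> x \<otimes> inv g) \<otimes> y = y \<otimes> (g \<otimes> x \<otimes> inv g)" if y: "y \<in> N" for y
    proof -
      define z where "z = inv g \<otimes> y \<otimes> g"
      have z: "z \<in> N" unfolding z_def using N.inv_op_closed1 g y by blast
      have y_eq: "y = g \<otimes> z \<otimes> inv g" unfolding z_def using g N[OF y] by (simp add: conjugation_is_surj)
      have "(g \<otimes> x \<otimes> inv g) \<otimes> y = g \<otimes> (x \<otimes> z) \<otimes> inv g"
        unfolding y_eq using g x N[OF z] by (simp add: m_assoc inv_mult_cancel)
      also have "\<dots> = g \<otimes> (z \<otimes> x) \<otimes> inv g" using x z by auto
      also have "\<dots> = y \<otimes> (g \<otimes> x \<otimes> inv g)"
        unfolding y_eq using g x N[OF z] by (simp add: m_assoc inv_mult_cancel)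
      finally show ?thesis .
    qed
    then show "g \<otimes> x \<otimes> inv g \<in> ?C" using g x by auto
  qed
qed

lemma (in group) comm_mem_iff_commute_mod:
  assumes "L \<lhd> G" "x \<in> carrier G" "y \<in> carrier G"
  shows "comm x y \<in> L \<longleftrightarrow> (L #> x) \<otimes>\<^bsub>G Mod L\<^esub> (L #> y) = (L #> y) \<otimes>\<^bsub>G Mod L\<^esub> (L #> x)"
proof -
  interpret L: normal L G by fact
  interpret h: group_hom G "G Mod L" "(#>) L" by (rule L.mod_hom)
  have "comm x y \<in> L \<longleftrightarrow> L #> comm x y = L" using L.coset_eq_iff[of "comm x y"] assms by simp
  also have "\<dots> \<longleftrightarrow> h.H.comm (L #> x) (L #> y) = \<one>\<^bsub>G Mod L\<^esub>"
    using h.hom_comm[OF assms(2,3)] by simp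
  also have "\<dots> \<longleftrightarrow> (L #> x) \<otimes>\<^bsub>G Mod L\<^esub> (L #> y) = (L #> y) \<otimes>\<^bsub>G Mod L\<^esub> (L #> x)"
    by (rule h.H.comm_eq_one_iff) (use assms in auto)
  finally show ?thesis .
qed

lemma (in group) centralizer_mod_normal:
  assumes "L \<lhd> G" "M \<lhd> G"
  shows "centralizer_mod G L M \<lhd> G"
proof -
  interpret L: normal L G by fact
  interpret h: group_hom G "G Mod L" "(#>) L" by (rule L.mod_hom)
  have M: "M \<subseteq> carrier G" using assms(2) normal_imp_subgroup subgroup.subset by blast
  have "(#>) L ` M \<lhd> G Mod L"
    using normal.surj_hom_normal_subgroup[OF assms(2) L.mod_hom] by (simp add: carrier_FactGroup)
  note n = h.preimage_normal[OF h.H.centralizer_normal[OF this]]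
  have "x \<in> centralizer_mod G L M \<longleftrightarrow> x \<in> carrier G \<and> L #> x \<in> carrier (G Mod L) \<and>
      (\<forall>y\<in>(#>) L ` M. (L #> x) \<otimes>\<^bsub>G Mod L\<^esub> y = y \<otimes>\<^bsub>G Mod L\<^esub> (L #> x))" for x
  proof (cases "x \<in> carrier G")
    case True
    then have "comm x y \<in> L \<longleftrightarrow> (L #> x) \<otimes>\<^bsub>G Mod L\<^esub> (L #> y) = (L #> y) \<otimes>\<^bsub>G Mod L\<^esub> (L #> x)"
      if "y \<in> M" for y
      using comm_mem_iff_commute_mod[OF assms(1) True] that M by blast
    then show ?thesis using True h.hom_closed[OF True] unfolding centralizer_mod_def by blast
  qed (simp add: centralizer_mod_def)
  then have "centralizer_mod G L M = {x \<in> carrier G. L #> x \<in> {x \<in> carrier (G Mod L).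
      \<forall>y\<in>(#>) L ` M. x \<otimes>\<^bsub>G Mod L\<^esub> y = y \<otimes>\<^bsub>G Mod L\<^esub> x}}"
    by blast
  then show ?thesis using n by (simp only:)
qed

lemma (in group) commutator_subgroup_least:
  assumes "subgroup X G" "\<And>h k. h \<in> H \<Longrightarrow> k \<in> K \<Longrightarrow> comm h k \<in> X"
  shows "commutator_subgroup G H K \<subseteq> X"
  unfolding commutator_subgroup_def using assms by (intro generate_subgroup_incl) auto

lemma (in group) comm_mem_commutator_subgroup:
  "h \<in> H \<Longrightarrow> k \<in> K \<Longrightarrow> comm h k \<in> commutator_subgroup G H K"
  unfolding commutator_subgroup_def by (rule generate.incl) blast

lemma (in group) comm_mem_derived:
  assumes "x \<in> E" "y \<in> E" shows "comm x y \<in> derived G E"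
  unfolding derived_def by (rule generate.incl) (use assms in blast)

lemma (in group) comm_closed:
  "subgroup M G \<Longrightarrow> x \<in> M \<Longrightarrow> y \<in> M \<Longrightarrow> comm x y \<in> M"
  by (simp add: subgroup.m_closed subgroup.m_inv_closed)

lemma (in group) commutator_subgroup_is_subgroup:
  assumes "H \<subseteq> carrier G" "K \<subseteq> carrier G" shows "subgroup (commutator_subgroup G H K) G"
  unfolding commutator_subgroup_def using assms
  by (intro generate_is_subgroup) (auto simp: subset_iff)

lemma (in group) rel_lcs_subgroup:
  assumes "subgroup M G" shows "subgroup (rel_lcs G M n) G \<and> rel_lcs G M n \<subseteq> M"
proof (induction n)
  case (Suc n)
  have "commutator_subgroup G (rel_lcs G M n) M \<subseteq> M"
    using Suc comm_closed[OF assms] by (intro commutator_subgroup_least assms) blast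
  moreover have "M \<subseteq> carrier G" "rel_lcs G M n \<subseteq> carrier G"
    using Suc subgroup.subset[OF assms] by blast+
  ultimately show ?case using commutator_subgroup_is_subgroup[of "rel_lcs G M n" M] by simp
qed (use assms in auto)

lemma (in group) rel_lcs_Suc_subset:
  assumes "subgroup X G" "rel_lcs G M n \<subseteq> Z" "\<And>z k. z \<in> Z \<Longrightarrow> k \<in> M \<Longrightarrow> comm z k \<in> X"
  shows "rel_lcs G M (Suc n) \<subseteq> X"
proof -
  have "commutator_subgroup G (rel_lcs G M n) M \<subseteq> X"
    using assms by (intro commutator_subgroup_least) blast+
  then show ?thesis by simp
qed

lemma (in group) rel_lcs_mono:
  assumes "N \<subseteq> M" "subgroup M G" shows "rel_lcs G N n \<subseteq> rel_lcs G M n"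
proof (induction n)
  case (Suc n)
  have "commutator_subgroup G (rel_lcs G N n) N \<subseteq> commutator_subgroup G (rel_lcs G M n) M"
    unfolding commutator_subgroup_def using Suc assms by (intro mono_generate) blast
  then show ?case by simp
qed (use assms in auto)

lemma (in group) rel_lcs_antimono:
  assumes "subgroup M G" "n \<le> m" shows "rel_lcs G M m \<subseteq> rel_lcs G M n"
  using assms(2)
proof (induction m rule: dec_induct)
  case (step m)
  have "rel_lcs G M (Suc m) \<subseteq> rel_lcs G M m"
  proof (induction m)
    case 0
    then show ?case using rel_lcs_subgroup[OF assms(1), of "Suc 0"] by simp
  next
    case (Suc m)
    then show ?case unfolding rel_lcs.simps(2) commutator_subgroup_def
      by (intro mono_generate) blast
  qed
  then show ?case using step by blast
qed auto

lemma (in group) commutator_subgroup_restrict: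
  assumes "subgroup S G" "H \<subseteq> S" "K \<subseteq> S"
  shows "commutator_subgroup (G\<lparr>carrier := S\<rparr>) H K = commutator_subgroup G H K"
proof -
  have "{h \<otimes> k \<otimes> inv\<^bsub>G\<lparr>carrier := S\<rparr>\<^esub> h \<otimes> inv\<^bsub>G\<lparr>carrier := S\<rparr>\<^esub> k | h k. h \<in> H \<and> k \<in> K}
    = {comm h k | h k. h \<in> H \<and> k \<in> K}"
    using assms m_inv_consistent[OF assms(1)] by (smt (verit, best) Collect_cong subsetD)
  moreover have "{comm h k | h k. h \<in> H \<and> k \<in> K} \<subseteq> S" using assms comm_closed by blast
  ultimately show ?thesis
    unfolding commutator_subgroup_def using generate_consistent assms(1) by simp
qed

lemma (in group) rel_lcs_restrict:
  assumes "subgroup S G" "subgroup M G" "M \<subseteq> S"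
  shows "rel_lcs (G\<lparr>carrier := S\<rparr>) M n = rel_lcs G M n"
proof (induction n)
  case (Suc n)
  have "rel_lcs G M n \<subseteq> S" using rel_lcs_subgroup[OF assms(2), of n] assms(3) by blast
  then show ?case using commutator_subgroup_restrict[OF assms(1) _ assms(3)] Suc by simp
qed simp

lemma (in group) lower_central_series_restrict:
  assumes "subgroup M G"
  shows "lower_central_series (G\<lparr>carrier := M\<rparr>) n = rel_lcs G M n"
proof -
  have "lower_central_series (G\<lparr>carrier := M\<rparr>) n = rel_lcs (G\<lparr>carrier := M\<rparr>) M n"
    by (induction n) auto
  then show ?thesis using rel_lcs_restrict[OF assms assms] by simp
qed

lemma (in group_hom) commutator_subgroup_img:
  assumes "A \<subseteq> carrier G" "B \<subseteq> carrier G"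
  shows "commutator_subgroup H (h ` A) (h ` B) = h ` commutator_subgroup G A B"
proof -
  have e: "{x \<otimes>\<^bsub>H\<^esub> y \<otimes>\<^bsub>H\<^esub> inv\<^bsub>H\<^esub> x \<otimes>\<^bsub>H\<^esub> inv\<^bsub>H\<^esub> y | x y. x \<in> h ` A \<and> y \<in> h ` B}
    = h ` {G.comm x y | x y. x \<in> A \<and> y \<in> B}" (is "?X = h ` ?Y")
  proof
    show "?X \<subseteq> h ` ?Y"
    proof
      fix z assume "z \<in> ?X"
      then obtain a b where "a \<in> A" "b \<in> B" "z = H.comm (h a) (h b)" by blast
      moreover from this have "z = h (G.comm a b)" using hom_comm assms by (simp add: subset_iff)
      ultimately show "z \<in> h ` ?Y" by blast
    qed
    show "h ` ?Y \<subseteq> ?X"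
    proof
      fix z assume "z \<in> h ` ?Y"
      then obtain a b where "a \<in> A" "b \<in> B" "z = h (G.comm a b)" by blast
      moreover from this have "z = H.comm (h a) (h b)" using hom_comm assms by (simp add: subset_iff)
      ultimately show "z \<in> ?X" by blast
    qed
  qed
  have "?Y \<subseteq> carrier G" using assms G.comm_closed[OF G.subgroup_self] by blast
  then show ?thesis unfolding commutator_subgroup_def e by (rule generate_img)
qed

lemma (in group_hom) rel_lcs_img:
  assumes "subgroup M G" shows "rel_lcs H (h ` M) n = h ` rel_lcs G M n"
proof (induction n)
  case (Suc n)
  have "rel_lcs G M n \<subseteq> carrier G" "M \<subseteq> carrier G"
    using G.rel_lcs_subgroup[OF assms] assms subgroup.subset by blast+
  then show ?case using Suc commutator_subgroup_img by simp
qed simp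

section \<open>Nilpotent sections have nilpotent lower central series\<close>

text \<open>The class equation: the orbits of conjugation other than \<open>{\<one>}\<close> cannot all have size divisible
by \<open>q\<close>, since together with \<open>{\<one>}\<close> they fill a group of order divisible by \<open>q\<close>.\<close>

lemma (in finite_group) center_of_primary_group:
  assumes q: "prime q" and prim: "\<And>p. prime p \<Longrightarrow> p dvd order G \<Longrightarrow> p = q" and nt: "order G \<noteq> 1"
  shows "\<exists>z\<in>carrier G. z \<noteq> \<one> \<and> (\<forall>g\<in>carrier G. z \<otimes> g = g \<otimes> z)"
proof (rule ccontr)
  assume no: "\<not> ?thesis"
  let ?\<phi> = "\<lambda>g. \<lambda>h\<in>carrier G. g \<otimes> h \<otimes> inv g"
  let ?O = "orbits G (carrier G) ?\<phi>"
  interpret A: group_action G "carrier G" ?\<phi> by (rule action_by_conjugation)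
  have one: "orbit G ?\<phi> \<one> = {\<one>}" unfolding orbit_def by (auto intro!: exI[of _ \<one>])
  have big: "q dvd card X" if X: "X \<in> ?O" "X \<noteq> {\<one>}" for X
  proof -
    obtain x where x: "x \<in> carrier G" "X = orbit G ?\<phi> x" using X(1) unfolding orbits_def by blast
    have dv: "card X dvd order G"
      using A.orbit_stabilizer_theorem[OF x(1)]
      by (intro dvdI[of _ _ "card (stabilizer G ?\<phi> x)"]) (simp only: x(2))
    have "card X \<noteq> 1"
    proof
      assume "card X = 1"
      then obtain w where "X = {w}" by (auto simp: card_Suc_eq)
      then have X1: "X = {x}" using A.orbit_refl[OF x(1)] x(2) by auto
      have "x \<otimes> g = g \<otimes> x" if g: "g \<in> carrier G" for g
      proof -
        have "g \<otimes> x \<otimes> inv g \<in> X" using x g unfolding orbit_def by auto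
        then have "g \<otimes> x \<otimes> inv g = x" using X1 by simp
        then show ?thesis using x(1) g by (simp add: inv_solve_right')
      qed
      then have "x = \<one>" using no x(1) by blast
      then show False using X(2) x(2) one by simp
    qed
    then obtain p where p: "prime p" "p dvd card X" using prime_factor_nat by blast
    then have "p = q" using prim[OF p(1) dvd_trans[OF p(2) dv]] by simp
    then show ?thesis using p by simp
  qed
  have "{\<one>} \<in> ?O" 
    unfolding orbits_def by (intro CollectI exI[of _ \<one>] conjI one[symmetric] one_closed)
  have fin: "finite ?O"
    by (rule finite_UnionD) (simp only: A.orbits_coverture finite_carrier)
  have "order G = (\<Sum>X\<in>?O. \<Sum>x\<in>X. 1)"
    using A.disjoint_sum[OF finite_carrier, of "\<lambda>_. 1::nat"] by (simp add: order_def)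
  also have "\<dots> = (\<Sum>X\<in>?O. card X)" by simp
  also have "\<dots> = 1 + (\<Sum>X\<in>?O - {{\<one>}}. card X)"
    using sum.remove[OF fin \<open>{\<one>} \<in> ?O\<close>, of card] by simp
  finally have "order G = 1 + (\<Sum>X\<in>?O - {{\<one>}}. card X)" .
  moreover have "q dvd (\<Sum>X\<in>?O - {{\<one>}}. card X)" using big by (intro dvd_sum) auto
  moreover obtain p where "prime p" "p dvd order G" using nt prime_factor_nat by blast
  then have "q dvd order G" using prim by blast
  ultimately have "q dvd 1" using dvd_add_left_iff[of q _ 1] by simp
  then show False using q by (simp add: prime_nat_iff)
qed

context finite_group
begin

lemma order_Mod:
  assumes "L \<lhd> G" shows "order (G Mod L) = card (carrier G) div card L" "finite (carrier (G Mod L))"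
proof -
  have "card (rcosets L) * card L = card (carrier G)"
    using lagrange[OF normal_imp_subgroup[OF assms]] by (simp add: order_def)
  then show "order (G Mod L) = card (carrier G) div card L"
    using card_pos[OF normal_imp_subgroup[OF assms]] unfolding order_def FactGroup_def
    by (metis nonzero_mult_div_cancel_right less_numeral_extra(3) partial_object.select_convs(1))
  show "finite (carrier (G Mod L))" by (simp add: carrier_FactGroup finite_carrier)
qed

lemma finite_group_Mod: "L \<lhd> G \<Longrightarrow> finite_group (G Mod L)"
  unfolding finite_group_def finite_group_axioms_def
  using normal.factorgroup_is_group order_Mod(2) by blast

lemma centralizer_mod_primary:
  assumes L: "L \<lhd> G" "L \<noteq> carrier G" and q: "prime q" "pi_section {q} L (carrier G)"
  shows "L \<subset> centralizer_mod G L (carrier G)"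
proof -
  interpret L: normal L G by fact
  interpret h: group_hom G "G Mod L" "(#>) L" by (rule L.mod_hom)
  interpret Q: finite_group "G Mod L" by (rule finite_group_Mod[OF L(1)])
  have "L \<subseteq> centralizer_mod G L (carrier G)"
  proof
    fix x assume x: "x \<in> L"
    have "comm x y \<in> L" if y: "y \<in> carrier G" for y
    proof -
      have "y \<otimes> inv x \<otimes> inv y \<in> L" using L.inv_op_closed2 x y by blast
      then have "x \<otimes> (y \<otimes> inv x \<otimes> inv y) \<in> L" using x by blast
      then show ?thesis using x y by (simp add: m_assoc)
    qed
    then show "x \<in> centralizer_mod G L (carrier G)" using x unfolding centralizer_mod_def by auto
  qed
  moreover have "order (G Mod L) \<noteq> 1"
  proof
    assume "order (G Mod L) = 1"
    then have "card (carrier G) div card L = 1" using order_Mod[OF L(1)] by simp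
    then have "pi_section {} L (carrier G)" unfolding pi_section_def using not_prime_unit by auto
    then show False using pi_section_empty[OF _ subgroup_self L.subset] L(2) L.is_subgroup by blast
  qed
  moreover have "\<And>p. prime p \<Longrightarrow> p dvd order (G Mod L) \<Longrightarrow> p = q"
    using q(2) order_Mod[OF L(1)] unfolding pi_section_def by simp
  ultimately obtain c where c: "c \<in> carrier (G Mod L)" "c \<noteq> L"
    "\<And>g. g \<in> carrier (G Mod L) \<Longrightarrow> c \<otimes>\<^bsub>G Mod L\<^esub> g = g \<otimes>\<^bsub>G Mod L\<^esub> c"
    using Q.center_of_primary_group[OF q(1)] by (metis one_FactGroup)
  obtain z where z: "z \<in> carrier G" "c = L #> z" using c(1) by (auto simp: carrier_FactGroup)
  have "z \<notin> L" using c(2) z L.coset_eq_iff by simp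
  moreover have "z \<in> centralizer_mod G L (carrier G)"
    unfolding centralizer_mod_def using z c(3) h.hom_closed comm_mem_iff_commute_mod[OF L(1) z(1)] by auto
  ultimately show ?thesis using \<open>L \<subseteq> _\<close> by blast
qed

lemma centralizer_mod_comm: "z \<in> centralizer_mod G L M \<Longrightarrow> y \<in> M \<Longrightarrow> comm z y \<in> L"
  unfolding centralizer_mod_def by simp

text \<open>Since a nontrivial \<open>q\<close>-group has a nontrivial centre, \<open>L\<close> can be enlarged to the preimage of the
centre of \<open>G / L\<close>, which costs one step of the lower central series.\<close>

lemma primary_section_lcs:
  assumes "L \<lhd> G" "prime q" "pi_section {q} L (carrier G)"
  shows "\<exists>n. rel_lcs G (carrier G) n \<subseteq> L"
  using assms(1,3)
proof (induction "card (carrier G) - card L" arbitrary: L rule: less_induct)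
  case less
  show ?case
  proof (cases "L = carrier G")
    case True
    then have "rel_lcs G (carrier G) 0 \<subseteq> L" by simp
    then show ?thesis by blast
  next
    case False
    let ?Z = "centralizer_mod G L (carrier G)"
    have Z: "?Z \<lhd> G" using centralizer_mod_normal[OF less.prems(1) normal_self] .
    have LZ: "L \<subset> ?Z" using centralizer_mod_primary[OF less.prems(1) False assms(2) less.prems(2)] .
    have "card L < card ?Z" 
      using psubset_card_mono[OF finite_subgroup[OF normal_imp_subgroup[OF Z]] LZ] .
    moreover have "card ?Z \<le> card (carrier G)"
      using card_mono[OF finite_carrier normal_subset_carrier[OF Z]] .
    moreover have "pi_section {q} ?Z (carrier G)"
      using pi_section_trans_normal[OF less.prems(1) Z normal_self, of "{q}"] LZ less.prems(2)
        normal_subset_carrier[OF Z] by auto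
    ultimately obtain n where n: "rel_lcs G (carrier G) n \<subseteq> ?Z"
      using less.hyps[OF _ Z] by fastforce
    have "rel_lcs G (carrier G) (Suc n) \<subseteq> L"
      by (rule rel_lcs_Suc_subset[OF normal_imp_subgroup[OF less.prems(1)] n centralizer_mod_comm])
    then show ?thesis by blast
  qed
qed

lemma normal_restrict:
  assumes "L \<lhd> G" "subgroup D G" "L \<subseteq> D" shows "L \<lhd> G\<lparr>carrier := D\<rparr>"
  using normal_restrict_supergroup assms by blast

lemma primary_normal_section_lcs:
  assumes "L \<lhd> G" "D \<lhd> G" "L \<subseteq> D" "prime q" "pi_section {q} L D"
  shows "\<exists>n. rel_lcs G D n \<subseteq> L"
proof -
  have sD: "subgroup D G" using normal_imp_subgroup[OF assms(2)] .
  interpret D: finite_group "G\<lparr>carrier := D\<rparr>" by (rule finite_group_restrict[OF sD])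
  have "L \<lhd> G\<lparr>carrier := D\<rparr>" using normal_restrict[OF assms(1) sD assms(3)] .
  then have "\<exists>n. rel_lcs (G\<lparr>carrier := D\<rparr>) D n \<subseteq> L"
    using D.primary_section_lcs[of L q] assms by simp
  then show ?thesis using rel_lcs_restrict[OF sD sD] by simp
qed

text \<open>\<open>D / L\<close> is an \<open>r\<close>-group for the normal \<open>r\<close>-complement \<open>L / K\<close> of \<open>D / K\<close>, so the lower central
series of \<open>D\<close> descends into \<open>L\<close>.  As the index \<open>|L : K|\<close> is prime to \<open>r\<close>, the subgroups that
contain a term of the series have the intersection \<open>K\<close>.\<close>

lemma nil_section_imp_lcs:
  assumes "K \<lhd> G" "D \<lhd> G" "K \<subseteq> D" "nil_section G K D"
  shows "\<exists>n. rel_lcs G D n \<subseteq> K"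
proof -
  let ?F = "{L. L \<lhd> G \<and> K \<subseteq> L \<and> L \<subseteq> D \<and> (\<exists>n. rel_lcs G D n \<subseteq> L)}"
  have sD: "subgroup D G" using normal_imp_subgroup[OF assms(2)] .
  have "D \<in> ?F" using assms by (auto intro: exI[of _ 0])
  define X where "X = \<Inter>?F"
  have X: "X \<lhd> G \<and> K \<subseteq> X \<and> X \<subseteq> D \<and> (\<exists>n. rel_lcs G D n \<subseteq> X)"
    unfolding X_def
  proof (rule Inter_family[where P = "\<lambda>L. L \<lhd> G \<and> K \<subseteq> L \<and> L \<subseteq> D \<and> (\<exists>n. rel_lcs G D n \<subseteq> L)"])
    show "finite ?F" by (rule finite_normals)
    show "?F \<noteq> {}" using \<open>D \<in> ?F\<close> by blast
    fix L N assume "L \<lhd> G \<and> K \<subseteq> L \<and> L \<subseteq> D \<and> (\<exists>n. rel_lcs G D n \<subseteq> L)"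
      "N \<lhd> G \<and> K \<subseteq> N \<and> N \<subseteq> D \<and> (\<exists>n. rel_lcs G D n \<subseteq> N)"
    then obtain l n where a: "rel_lcs G D l \<subseteq> L" "rel_lcs G D n \<subseteq> N" "L \<lhd> G" "N \<lhd> G"
      "K \<subseteq> L \<inter> N" "L \<inter> N \<subseteq> D" by blast
    have "rel_lcs G D (max l n) \<subseteq> L \<inter> N"
      using rel_lcs_antimono[OF sD, of l "max l n"] rel_lcs_antimono[OF sD, of n "max l n"] a by auto
    then show "L \<inter> N \<lhd> G \<and> K \<subseteq> L \<inter> N \<and> L \<inter> N \<subseteq> D \<and> (\<exists>n. rel_lcs G D n \<subseteq> L \<inter> N)"
      using normal_Int[OF a(3,4)] a by blast
  qed blast
  have "pi_section {} K X" unfolding pi_section_def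
  proof (intro allI impI)
    fix r assume r: "prime r" "r dvd card X div card K"
    have "complemented_section G r K D" using assms(4) r(1) by (simp add: nil_section_def)
    then obtain L where L: "L \<lhd> G" "K \<subseteq> L" "L \<subseteq> D" "pi_section (- {r}) K L" "pi_section {r} L D"
      unfolding complemented_section_def by blast
    have "L \<in> ?F" using L primary_normal_section_lcs[OF L(1) assms(2) L(3) r(1) L(5)] by blast
    then have "X \<subseteq> L" unfolding X_def by blast
    then have "pi_section (- {r}) K X"
      using pi_section_trans_normal[OF assms(1) _ L(1), of X] X L(4) by blast
    then show "r \<in> {}" using r unfolding pi_section_def by blast
  qed
  from pi_section_empty[OF _ _ _ this] have "K = X"
    using normal_imp_subgroup[OF assms(1)] normal_imp_subgroup[of X G] X by blast
  then show ?thesis using X by simp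
qed

end

section \<open>Sylow subgroups of nilpotent sections\<close>

lemma (in group) conj_hom:
  assumes "x \<in> carrier G" shows "group_hom G G (\<lambda>h. x \<otimes> h \<otimes> inv x)"
proof (unfold_locales, rule homI)
  show "x \<otimes> h \<otimes> inv x \<in> carrier G" if "h \<in> carrier G" for h using that assms by simp
  show "x \<otimes> (h \<otimes> k) \<otimes> inv x = x \<otimes> h \<otimes> inv x \<otimes> (x \<otimes> k \<otimes> inv x)"
    if "h \<in> carrier G" "k \<in> carrier G" for h k
    using that assms by (simp add: m_assoc inv_mult_cancel)
qed

context finite_group
begin

lemma conj_subgroup:
  assumes "x \<in> carrier G" "subgroup Q G"
  shows "subgroup ((\<lambda>h. x \<otimes> h \<otimes> inv x) ` Q) G" "card ((\<lambda>h. x \<otimes> h \<otimes> inv x) ` Q) = card Q"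
proof -
  show "subgroup ((\<lambda>h. x \<otimes> h \<otimes> inv x) ` Q) G"
    using group_hom.subgroup_img_is_subgroup[OF conj_hom[OF assms(1)] assms(2)] .
  have "inj_on (\<lambda>h. x \<otimes> h \<otimes> inv x) Q"
    using assms(1) subgroup.mem_carrier[OF assms(2)] by (auto simp: inj_on_def)
  then show "card ((\<lambda>h. x \<otimes> h \<otimes> inv x) ` Q) = card Q" by (rule card_image)
qed

lemma normal_subset_conj:
  assumes "K \<lhd> G" "K \<subseteq> Q" "x \<in> carrier G"
  shows "K \<subseteq> (\<lambda>h. x \<otimes> h \<otimes> inv x) ` Q"
proof
  fix k assume k: "k \<in> K"
  have kG: "k \<in> carrier G" using k normal_subset_carrier[OF assms(1)] by blast
  have "inv x \<otimes> k \<otimes> x \<in> K" using normal.inv_op_closed1[OF assms(1,3) k] .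
  moreover have "k = x \<otimes> (inv x \<otimes> k \<otimes> x) \<otimes> inv x"
    using conjugation_is_surj[OF assms(3) kG] by simp
  ultimately show "k \<in> (\<lambda>h. x \<otimes> h \<otimes> inv x) ` Q" using assms(2) by blast
qed

text \<open>The image in \<open>M / K\<close> of a Sylow subgroup of \<open>M\<close>.\<close>

lemma sylow_section_exists:
  assumes "K \<lhd> G" "subgroup M G" "K \<subseteq> M" "prime q"
  obtains Q where "subgroup Q G" "K \<subseteq> Q" "Q \<subseteq> M" "pi_section {q} K Q" "pi_section (- {q}) Q M"
proof -
  interpret M: finite_group "G\<lparr>carrier := M\<rparr>" by (rule finite_group_restrict[OF assms(2)])
  define a where "a = multiplicity q (card M)"
  have "card M \<noteq> 0" using card_pos[OF assms(2)] by simp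
  moreover have "\<not> is_unit q" using assms(4) not_prime_unit by blast
  ultimately obtain m where m: "card M = q ^ a * m" "\<not> q dvd m"
    unfolding a_def using multiplicity_decompose' by blast
  obtain H where "subgroup H (G\<lparr>carrier := M\<rparr>)" and cH: "card H = q ^ a"
    using sylow_thm[OF assms(4) M.group_axioms _ M.finite_carrier, of a m] m by (auto simp: order_def)
  then have H: "subgroup H G" "H \<subseteq> M" using incl_subgroup[OF assms(2)] subgroup.subset by fastforce+
  have sK: "subgroup K G" by (rule normal_imp_subgroup[OF assms(1)])
  let ?Q = "K <#> H"
  have sQ: "subgroup ?Q G" by (rule mult_subgroup[OF assms(1) H(1)])
  have QM: "?Q \<subseteq> M" by (rule mult_least[OF assms(2,3) H(2)])
  have HQ: "H \<subseteq> ?Q" by (rule subset_mult_right[OF sK H(1)])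
  have "pi_section {q} (K \<inter> H) H" unfolding pi_section_def
  proof (intro allI impI)
    fix p assume p: "prime p" "p dvd card H div card (K \<inter> H)"
    have "card (K \<inter> H) dvd card H"
      using subgroup_card_dvd[OF subgroups_Inter_pair[OF sK H(1)] H(1)] by simp
    then have "p dvd q ^ a" using p(2) cH by (metis dvd_div_mult_self dvd_mult2)
    then show "p \<in> {q}" using p(1) assms(4) by (metis prime_dvd_power primes_dvd_imp_eq singletonI)
  qed
  then have "pi_section {q} K ?Q" using pi_section_mult_iff(1)[OF assms(1) H(1)] by simp
  moreover have "pi_section (- {q}) H M"
    unfolding pi_section_def cH m(1) using m(2) assms(4) prime_gt_0_nat by auto
  then have "pi_section (- {q}) ?Q M"
    using pi_section_trans[OF H(1) sQ assms(2) HQ QM] by simp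
  ultimately show thesis using that[OF sQ subset_mult_left[OF sK H(1)] QM] by simp
qed

text \<open>If a Sylow subgroup \<open>Q / K\<close> of \<open>M / K\<close> is normal in \<open>N / K\<close>, it contains every \<open>q\<close>-subgroup
\<open>R / K\<close> of \<open>N / K\<close>, since \<open>QR / Q\<close> is both a \<open>q\<close>-group and a \<open>q'\<close>-group.  This replaces the
conjugacy of Sylow subgroups in what follows.\<close>

lemma sylow_section_absorbs:
  assumes "subgroup N G" "Q \<lhd> G\<lparr>carrier := N\<rparr>" "subgroup M G" "N \<subseteq> M"
    and "subgroup K G" "K \<subseteq> Q" "pi_section {q} K Q" "pi_section (- {q}) Q M"
    and "subgroup R G" "K \<subseteq> R" "R \<subseteq> N" "pi_section {q} K R"
  shows "R \<subseteq> Q"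
proof -
  interpret N: finite_group "G\<lparr>carrier := N\<rparr>" by (rule finite_group_restrict[OF assms(1)])
  have sQN: "subgroup Q (G\<lparr>carrier := N\<rparr>)" by (rule normal_imp_subgroup[OF assms(2)])
  have sQ: "subgroup Q G" by (rule incl_subgroup[OF assms(1) sQN])
  have sRN: "subgroup R (G\<lparr>carrier := N\<rparr>)" by (rule subgroup_incl[OF assms(9,1,11)])
  have sQR: "subgroup (Q <#> R) G" "Q <#> R \<subseteq> N"
    using incl_subgroup[OF assms(1) N.mult_subgroup[OF assms(2) sRN]]
      subgroup.subset[OF N.mult_subgroup[OF assms(2) sRN]] by simp_all
  have Q: "Q \<subseteq> Q <#> R" "R \<subseteq> Q <#> R" using subset_mult_left subset_mult_right sQ assms(9) by blast+
  have sI: "subgroup (Q \<inter> R) G" by (rule subgroups_Inter_pair[OF sQ assms(9)])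
  have "pi_section {q} (Q \<inter> R) R"
    using pi_section_trans[OF assms(5) sI assms(9), of "{q}"] assms(6,10,12) by simp
  then have "pi_section {q} Q (Q <#> R)" using N.pi_section_mult_iff(1)[OF assms(2) sRN] by simp
  moreover have "pi_section (- {q}) Q (Q <#> R)"
    using pi_section_trans[OF sQ sQR(1) assms(3), of "- {q}"] Q(1) sQR(2) assms(4,8) by simp
  ultimately have "pi_section {} Q (Q <#> R)" using pi_section_both by fastforce
  then show ?thesis using pi_section_empty[OF sQ sQR(1) Q(1)] Q(2) by simp
qed

text \<open>Normalizers grow in nilpotent groups.  Let \<open>N\<close> be the normalizer of \<open>Q\<close> in \<open>M\<close>.  If \<open>N\<close>
contains a term of the lower central series of \<open>M\<close>, the previous term normalizes \<open>N\<close>; it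
conjugates \<open>Q\<close> to a \<open>q\<close>-section inside \<open>N\<close>, which is \<open>Q\<close> by \<open>sylow_section_absorbs\<close>, and so it
lies in \<open>N\<close>.  Climbing up the series, \<open>N = M\<close>; and then any conjugate of \<open>Q\<close> under \<open>G\<close> is
absorbed by \<open>Q\<close> in the same way.\<close>

lemma sylow_section_normal:
  assumes K: "K \<lhd> G" and M: "M \<lhd> G" and KM: "K \<subseteq> M" and nil: "rel_lcs G M n \<subseteq> K"
    and Q: "subgroup Q G" "K \<subseteq> Q" "Q \<subseteq> M" "pi_section {q} K Q" "pi_section (- {q}) Q M"
  shows "Q \<lhd> G"
proof -
  let ?c = "\<lambda>x h. x \<otimes> h \<otimes> inv x"
  have sM: "subgroup M G" and sK: "subgroup K G" using normal_imp_subgroup[OF K] normal_imp_subgroup[OF M] by simp_all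
  have QG: "h \<in> carrier G" if "h \<in> Q" for h using subgroup.mem_carrier[OF Q(1) that] .
  have MG: "h \<in> carrier G" if "h \<in> M" for h using subgroup.mem_carrier[OF sM that] .
  have cc: "?c x (?c y h) = ?c (x \<otimes> y) h" if "x \<in> carrier G" "y \<in> carrier G" "h \<in> carrier G" for x y h
    using that by (simp add: inv_mult_group m_assoc)
  define N where "N = {x \<in> M. \<forall>h\<in>carrier G. h \<in> Q \<longleftrightarrow> ?c x h \<in> Q}"
  have sN: "subgroup N G"
  proof (rule subgroupI)
    show "N \<subseteq> carrier G" using MG unfolding N_def by blast
    have "\<one> \<in> N" unfolding N_def using subgroup.one_closed[OF sM] by auto
    then show "N \<noteq> {}" by blast
    show "x \<otimes> y \<in> N" if x: "x \<in> N" and y: "y \<in> N" for x y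
    proof -
      have xy: "x \<in> M" "y \<in> M" using x y unfolding N_def by simp_all
      have "h \<in> Q \<longleftrightarrow> ?c (x \<otimes> y) h \<in> Q" if h: "h \<in> carrier G" for h
      proof -
        have "h \<in> Q \<longleftrightarrow> ?c y h \<in> Q" using y h unfolding N_def by blast
        also have "\<dots> \<longleftrightarrow> ?c x (?c y h) \<in> Q" using x h MG[OF xy(2)] unfolding N_def by simp
        finally show ?thesis using cc[OF MG[OF xy(1)] MG[OF xy(2)] h] by simp
      qed
      then show ?thesis unfolding N_def using subgroup.m_closed[OF sM xy] by blast
    qed
    show "inv x \<in> N" if x: "x \<in> N" for x
    proof -
      have xM: "x \<in> M" using x unfolding N_def by simp
      have "h \<in> Q \<longleftrightarrow> ?c (inv x) h \<in> Q" if h: "h \<in> carrier G" for h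
      proof -
        have "?c (inv x) h \<in> Q \<longleftrightarrow> ?c x (?c (inv x) h) \<in> Q"
          using x h MG[OF xM] unfolding N_def by simp
        also have "?c x (?c (inv x) h) = h" using cc[OF MG[OF xM] _ h, of "inv x"] MG[OF xM] h by simp
        finally show ?thesis by simp
      qed
      then show ?thesis unfolding N_def using subgroup.m_inv_closed[OF sM xM] by blast
    qed
  qed
  have NM: "N \<subseteq> M" unfolding N_def by blast
  have QN: "Q \<subseteq> N"
  proof
    fix x assume x: "x \<in> Q"
    have "h \<in> Q \<longleftrightarrow> ?c x h \<in> Q" if h: "h \<in> carrier G" for h
    proof
      assume "h \<in> Q" then show "?c x h \<in> Q"
        using x subgroup.m_closed[OF Q(1)] subgroup.m_inv_closed[OF Q(1)] by simp
    next
      assume "?c x h \<in> Q"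
      then have "inv x \<otimes> ?c x h \<otimes> x \<in> Q"
        using x subgroup.m_closed[OF Q(1)] subgroup.m_inv_closed[OF Q(1)] by simp
      then show "h \<in> Q" using QG[OF x] h by (simp add: m_assoc inv_mult_cancel)
    qed
    then show "x \<in> N" unfolding N_def using x Q(3) by blast
  qed
  interpret N: finite_group "G\<lparr>carrier := N\<rparr>" by (rule finite_group_restrict[OF sN])
  have QnN: "Q \<lhd> G\<lparr>carrier := N\<rparr>"
  proof (rule N.normal_invI)
    show "subgroup Q (G\<lparr>carrier := N\<rparr>)" by (rule subgroup_incl[OF Q(1) sN QN])
    show "x \<otimes>\<^bsub>G\<lparr>carrier := N\<rparr>\<^esub> h \<otimes>\<^bsub>G\<lparr>carrier := N\<rparr>\<^esub> inv\<^bsub>G\<lparr>carrier := N\<rparr>\<^esub> x \<in> Q"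
      if x: "x \<in> carrier (G\<lparr>carrier := N\<rparr>)" and h: "h \<in> Q" for x h
    proof -
      have xN: "x \<in> N" using x by simp
      then have "?c x h \<in> Q" using h QG unfolding N_def by blast
      then show ?thesis using m_inv_consistent[OF sN xN] by simp
    qed
  qed
  have conj: "?c x ` Q \<subseteq> Q" if x: "x \<in> carrier G" "?c x ` Q \<subseteq> N" for x
  proof (rule sylow_section_absorbs[OF sN QnN sM NM sK Q(2,4,5) conj_subgroup(1)[OF x(1) Q(1)] _ x(2)])
    show "K \<subseteq> ?c x ` Q" by (rule normal_subset_conj[OF K Q(2) x(1)])
    show "pi_section {q} K (?c x ` Q)"
      using Q(4) conj_subgroup(2)[OF x(1) Q(1)] unfolding pi_section_def by simp
  qed
  have step: "rel_lcs G M i \<subseteq> N" if IH: "rel_lcs G M (Suc i) \<subseteq> N" for i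
  proof
    have sL: "subgroup (rel_lcs G M i) G" "rel_lcs G M i \<subseteq> M" using rel_lcs_subgroup[OF sM] by auto
    have one: "?c x ` Q \<subseteq> Q" if x: "x \<in> rel_lcs G M i" for x
    proof (rule conj)
      show xG: "x \<in> carrier G" using x sL MG by blast
      show "?c x ` Q \<subseteq> N"
      proof
        fix y assume "y \<in> ?c x ` Q"
        then obtain h where h: "h \<in> Q" "y = ?c x h" by blast
        have "comm x h \<in> N" using IH comm_mem_commutator_subgroup[OF x, of h M] h(1) Q(3) by auto
        then have "comm x h \<otimes> h \<in> N" using h(1) QN subgroup.m_closed[OF sN] by blast
        moreover have "comm x h \<otimes> h = y" using h QG xG by (simp add: m_assoc)
        ultimately show "y \<in> N" by simp
      qed
    qed
    fix x assume x: "x \<in> rel_lcs G M i"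
    have xG: "x \<in> carrier G" using x sL MG by blast
    have "h \<in> Q \<longleftrightarrow> ?c x h \<in> Q" if h: "h \<in> carrier G" for h
    proof
      assume "h \<in> Q" then show "?c x h \<in> Q" using one[OF x] by blast
    next
      assume "?c x h \<in> Q"
      then have "?c (inv x) (?c x h) \<in> Q" using one[OF subgroup.m_inv_closed[OF sL(1) x]] by blast
      then show "h \<in> Q" using cc[OF _ xG h, of "inv x"] xG h by simp
    qed
    then show "x \<in> N" unfolding N_def using x sL(2) by blast
  qed
  have "rel_lcs G M (n - i) \<subseteq> N" for i
  proof (induction i)
    case 0
    then show ?case using nil Q(2) QN by simp
  next
    case (Suc i)
    then show ?case using step[of "n - Suc i"]
      by (cases "i < n") (simp_all add: Suc_diff_Suc)
  qed
  from this[of n] have N_eq: "N = M" using NM by simp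
  show ?thesis
  proof (rule normal_invI[OF Q(1)])
    fix x h assume x: "x \<in> carrier G" and h: "h \<in> Q"
    have "?c x ` Q \<subseteq> N" unfolding N_eq using normal.inv_op_closed2[OF M x] Q(3) by blast
    then show "?c x h \<in> Q" using conj[OF x] h by blast
  qed
qed

text \<open>The largest normal \<open>r'\<close>-section \<open>L / K\<close> contains every Sylow section for primes \<open>q \<noteq> r\<close>,
because these are normal; so no prime other than \<open>r\<close> is left to divide \<open>|M : L|\<close>.\<close>

lemma lcs_imp_complemented_section:
  assumes "K \<lhd> G" "M \<lhd> G" "K \<subseteq> M" "rel_lcs G M n \<subseteq> K" "prime r"
  shows "complemented_section G r K M"
proof -
  obtain L where L: "L \<lhd> G" "K \<subseteq> L" "L \<subseteq> M" "pi_section (- {r}) K L"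
    "\<And>N. N \<lhd> G \<Longrightarrow> K \<subseteq> N \<Longrightarrow> N \<subseteq> M \<Longrightarrow> pi_section (- {r}) K N \<Longrightarrow> N \<subseteq> L"
    by (rule greatest_pi_section[where \<pi> = "- {r}", OF assms(1,3,2)]) (rule that, assumption+)
  have "pi_section {r} L M" unfolding pi_section_def
  proof (intro allI impI)
    fix q assume q: "prime q" "q dvd card M div card L"
    show "q \<in> {r}"
    proof (rule ccontr)
      assume "q \<notin> {r}"
      obtain Q where Q: "subgroup Q G" "K \<subseteq> Q" "Q \<subseteq> M" "pi_section {q} K Q" "pi_section (- {q}) Q M"
        using sylow_section_exists[OF assms(1) normal_imp_subgroup[OF assms(2)] assms(3) q(1)] .
      have Qn: "Q \<lhd> G" using sylow_section_normal[OF assms(1-4) Q] .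
      have "pi_section (- {r}) K Q" using pi_section_mono[OF Q(4), of "- {r}"] \<open>q \<notin> {r}\<close> by simp
      from L(5)[OF Qn Q(2,3) this] have "Q \<subseteq> L" .
      then have "pi_section (- {q}) L M"
        using pi_section_trans_normal[OF Qn L(1) assms(2) _ L(3)] Q(5) by simp
      then show False using q unfolding pi_section_def by blast
    qed
  qed
  then show ?thesis unfolding complemented_section_def using L(1-4) by blast
qed

lemma nil_section_iff_lcs:
  assumes "K \<lhd> G" "M \<lhd> G" "K \<subseteq> M"
  shows "nil_section G K M \<longleftrightarrow> (\<exists>n. rel_lcs G M n \<subseteq> K)"
proof
  show "nil_section G K M" if "\<exists>n. rel_lcs G M n \<subseteq> K"
    unfolding nil_section_def using that lcs_imp_complemented_section[OF assms] by blast
qed (rule nil_section_imp_lcs[OF assms])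

end

section \<open>Stripping a primary layer from a Hall subgroup\<close>

context finite_group
begin

text \<open>The soluble case of the Hall-Higman lemma: if \<open>L = O\<^bsub>p'\<^esub>\<close> and \<open>M / L = O\<^sub>p\<close> modulo \<open>K\<close>, then
\<open>M / L\<close> contains its own centralizer \<open>C / L\<close> in \<open>G / L\<close>.  The derived series of \<open>C\<close> ends in
\<open>M\<close>, so it suffices to see that a term \<open>E\<close> lies in \<open>M\<close> when its derived subgroup does.
In that case \<open>E\<close> centralizes its own derived subgroup modulo \<open>L\<close>, and \<open>E / (E \<inter> L)\<close> has class
at most two.  Its normal \<open>p\<close>-complement gives rise to a normal \<open>p'\<close>-subgroup, which lies in \<open>L\<close>
by maximality of \<open>L\<close>; what is left is a \<open>p\<close>-group, which lies in \<open>M\<close> by maximality of \<open>M\<close>.\<close>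

lemma hall_higman:
  assumes solv: "solvable G" and p: "prime p"
    and K: "K \<lhd> G" and L: "L \<lhd> G" "K \<subseteq> L" "pi_section (- {p}) K L"
      "\<And>N. N \<lhd> G \<Longrightarrow> K \<subseteq> N \<Longrightarrow> pi_section (- {p}) K N \<Longrightarrow> N \<subseteq> L"
    and M: "M \<lhd> G" "L \<subseteq> M"
      "\<And>N. N \<lhd> G \<Longrightarrow> L \<subseteq> N \<Longrightarrow> pi_section {p} L N \<Longrightarrow> N \<subseteq> M"
  shows "centralizer_mod G L M \<subseteq> M"
proof -
  let ?C = "centralizer_mod G L M"
  let ?D = "\<lambda>i. (derived G ^^ i) ?C"
  have C: "?C \<lhd> G" by (rule centralizer_mod_normal[OF L(1) M(1)])
  have Dn: "?D i \<lhd> G" for i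
    by (induction i) (use C derived_is_normal in auto)
  have DC: "?D i \<subseteq> ?C" for i
  proof (induction i)
    case (Suc i)
    have "derived G (?D i) \<subseteq> ?D i" by (rule derived_incl[OF subset_refl normal_imp_subgroup[OF Dn]])
    then show ?case using Suc by simp
  qed simp
  obtain n where n: "(derived G ^^ n) (carrier G) = {\<one>}"
    using solv solvable_iff_trivial_derived_seq by blast
  have "?D n \<subseteq> {\<one>}"
    using mono_exp_of_derived[OF normal_subset_carrier[OF C], of n] n by simp
  then have base: "?D n \<subseteq> M"
    using subgroup.one_closed[OF normal_imp_subgroup[OF M(1)]] by blast
  have step: "?D i \<subseteq> M" if IH: "?D (Suc i) \<subseteq> M" for i
  proof -
    define E where "E = ?D i"
    have E: "E \<lhd> G" and EC: "E \<subseteq> ?C" and dE: "derived G E \<subseteq> M"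
      using Dn DC IH unfolding E_def by simp_all
    have sE: "subgroup E G" by (rule normal_imp_subgroup[OF E])
    have EL: "E \<inter> L \<lhd> G" by (rule normal_Int[OF E L(1)])
    \<comment> \<open>Two steps of the lower central series of \<open>E\<close> lead into \<open>E \<inter> L\<close>.\<close>
    have "rel_lcs G E (Suc 0) \<subseteq> E \<inter> M"
    proof (rule rel_lcs_Suc_subset[OF subgroups_Inter_pair[OF sE normal_imp_subgroup[OF M(1)]]])
      show "rel_lcs G E 0 \<subseteq> E" by simp
      fix z e assume ze: "z \<in> E" "e \<in> E"
      show "comm z e \<in> E \<inter> M" using comm_mem_derived[OF ze] dE comm_closed[OF sE ze] by blast
    qed
    then have "rel_lcs G E (Suc (Suc 0)) \<subseteq> E \<inter> L"
    proof (rule rel_lcs_Suc_subset[OF normal_imp_subgroup[OF EL]])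
      fix z e assume z: "z \<in> E \<inter> M" and e: "e \<in> E"
      have "comm e z \<in> L" using centralizer_mod_comm[of e L M z] e z EC by blast
      then have "inv (comm e z) \<in> L" by (rule subgroup.m_inv_closed[OF normal_imp_subgroup[OF L(1)]])
      moreover have "inv (comm e z) = comm z e"
        by (rule inv_comm) (use e z subgroup.mem_carrier[OF sE] in auto)
      moreover have "comm z e \<in> E" by (rule comm_closed[OF sE]) (use z e in auto)
      ultimately show "comm z e \<in> E \<inter> L" by simp
    qed
    from lcs_imp_complemented_section[OF EL E Int_lower1 this p]
    obtain X where X: "X \<lhd> G" "E \<inter> L \<subseteq> X" "X \<subseteq> E" "pi_section (- {p}) (E \<inter> L) X" "pi_section {p} X E"
      unfolding complemented_section_def by blast
    have LX: "L <#> X \<lhd> G" by (rule normal_mult[OF L(1) X(1)])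
    have "L \<inter> X = E \<inter> L" using X(2,3) by blast
    then have "pi_section (- {p}) L (L <#> X)"
      using pi_section_mult_iff(1)[OF L(1) normal_imp_subgroup[OF X(1)]] X(4) by simp
    moreover have "L \<subseteq> L <#> X" by (rule subset_mult_left_normal[OF L(1) X(1)])
    ultimately have "pi_section (- {p}) K (L <#> X)" "K \<subseteq> L <#> X"
      using pi_section_trans_normal[OF K L(1) LX L(2)] L(2,3) by blast+
    then have "L <#> X \<subseteq> L" using L(4)[OF LX] by simp
    then have "X \<subseteq> L" using subset_mult_right_normal[OF L(1) X(1)] by blast
    then have "X = L \<inter> E" using X(2,3) by blast
    then have "pi_section {p} L (L <#> E)"
      using pi_section_mult_iff(1)[OF L(1) sE] X(5) by simp
    then have "L <#> E \<subseteq> M"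
      using M(3)[OF normal_mult[OF L(1) E] subset_mult_left_normal[OF L(1) E]] by simp
    then show ?thesis using subset_mult_right_normal[OF L(1) E] unfolding E_def by blast
  qed
  have "?D (n - i) \<subseteq> M" for i
  proof (induction i)
    case 0
    then show ?case using base by simp
  next
    case (Suc i)
    show ?case
    proof (cases "i < n")
      case True
      then have "n - i = Suc (n - Suc i)" by simp
      then show ?thesis using step[of "n - Suc i"] Suc by simp
    next
      case False
      then show ?thesis using Suc by simp
    qed
  qed
  from this[of n] show ?thesis by simp
qed

lemma Int_normal_restrict: "subgroup S G \<Longrightarrow> K \<lhd> G \<Longrightarrow> S \<inter> K \<lhd> G\<lparr>carrier := S\<rparr>"
  by (simp add: second_isomorphism_grp.normal_subgrp_intersection_normal
      second_isomorphism_grp_axioms_def second_isomorphism_grp_def)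

text \<open>A subgroup \<open>S\<close> that covers the layer \<open>M / L\<close> loses at least one unit of length on removal of
\<open>S \<inter> M\<close>.  Let \<open>M1\<close> be the bottom \<open>p\<close>-nilpotent section of \<open>S\<close> and \<open>L1\<close> its normal
\<open>p\<close>-complement.  Modulo \<open>L\<close> the subgroup \<open>L1\<close> is a \<open>p'\<close>-group normalized by the \<open>p\<close>-group
\<open>M / L\<close> and normalizing it, so the two commute and \<open>L1\<close> lies in \<open>M\<close> by \<open>hall_higman\<close>.
Consequently \<open>M1\<close> modulo \<open>S \<inter> M\<close> is a \<open>p\<close>-group, which is invisible to the length at
a prime \<open>r \<noteq> p\<close>.\<close>

lemma prime_height_le_strip_primary:
  assumes solv: "solvable G" and p: "prime p" and r: "prime r" "r \<noteq> p"
    and K: "K \<lhd> G" and L: "L \<lhd> G" "K \<subseteq> L" "pi_section (- {p}) K L"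
      "\<And>N. N \<lhd> G \<Longrightarrow> K \<subseteq> N \<Longrightarrow> pi_section (- {p}) K N \<Longrightarrow> N \<subseteq> L"
    and M: "M \<lhd> G" "L \<subseteq> M" "pi_section {p} L M"
      "\<And>N. N \<lhd> G \<Longrightarrow> L \<subseteq> N \<Longrightarrow> pi_section {p} L N \<Longrightarrow> N \<subseteq> M"
    and S: "subgroup S G" "M \<subseteq> L <#> S"
    and h: "prime_height_le (G\<lparr>carrier := S\<rparr>) p (Suc n) (S \<inter> K)"
  shows "prime_height_le (G\<lparr>carrier := S\<rparr>) r n (S \<inter> M)"
proof -
  interpret S: finite_group "G\<lparr>carrier := S\<rparr>" by (rule finite_group_restrict[OF S(1)])
  obtain M1 where M1: "M1 \<lhd> G\<lparr>carrier := S\<rparr>" "S \<inter> K \<subseteq> M1"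
      "complemented_section (G\<lparr>carrier := S\<rparr>) p (S \<inter> K) M1" "height_le (G\<lparr>carrier := S\<rparr>) n M1"
    using h unfolding prime_height_le.simps by blast
  obtain L1 where L1: "L1 \<lhd> G\<lparr>carrier := S\<rparr>" "S \<inter> K \<subseteq> L1" "L1 \<subseteq> M1"
      "pi_section (- {p}) (S \<inter> K) L1" "pi_section {p} L1 M1"
    using M1(3) unfolding complemented_section_def by blast
  have sL: "subgroup L G" and sM: "subgroup M G" and sK: "subgroup K G"
    using L(1) M(1) K normal_imp_subgroup by blast+
  have sL1: "subgroup L1 G" by (rule incl_subgroup[OF S(1) normal_imp_subgroup[OF L1(1)]])
  have L1S: "L1 \<subseteq> S" using S.normal_subset_carrier[OF L1(1)] by simp
  have SG: "x \<in> carrier G" if "x \<in> S" for x using subgroup.mem_carrier[OF S(1) that] .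
  have sSK: "subgroup (S \<inter> K) G" by (rule subgroups_Inter_pair[OF S(1) sK])
  have sL1L: "subgroup (L1 \<inter> L) G" by (rule subgroups_Inter_pair[OF sL1 sL])
  have sX: "subgroup (L1 \<inter> M) G" by (rule subgroups_Inter_pair[OF sL1 sM])
  have "pi_section (- {p}) (S \<inter> K) (L1 \<inter> M)" "S \<inter> K \<subseteq> L1 \<inter> L"
    using pi_section_trans[OF sSK sX sL1, of "- {p}"] L1(2,4) L(2) M(2) by auto
  \<comment> \<open>\<open>(L1 \<inter> M) / (L1 \<inter> L)\<close> is a \<open>p'\<close>-group as a section of \<open>L1 / (S \<inter> K)\<close>, and a \<open>p\<close>-group since it embeds in \<open>M / L\<close>.\<close>
  then have 1: "pi_section (- {p}) (L1 \<inter> L) (L1 \<inter> M)"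
    using pi_section_trans[OF sSK sL1L sX, of "- {p}"] M(2) by blast
  have LX: "L <#> (L1 \<inter> M) \<subseteq> M" by (rule mult_least[OF sM M(2)]) simp
  have "pi_section {p} L (L <#> (L1 \<inter> M))"
    using pi_section_trans[OF sL mult_subgroup[OF L(1) sX] sM subset_mult_left[OF sL sX] LX, of "{p}"] M(3)
    by simp
  moreover have "L \<inter> (L1 \<inter> M) = L1 \<inter> L" using M(2) by blast
  ultimately have "pi_section {p} (L1 \<inter> L) (L1 \<inter> M)"
    using pi_section_mult_iff(1)[OF L(1) sX] by simp
  then have "pi_section {} (L1 \<inter> L) (L1 \<inter> M)" using pi_section_both[OF 1] by fastforce
  then have "L1 \<inter> L = L1 \<inter> M" using pi_section_empty[OF sL1L sX] M(2) by blast
  then have L1M: "L1 \<inter> M \<subseteq> L" by blast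
  have "L1 \<subseteq> centralizer_mod G L M"
  proof
    fix x assume x: "x \<in> L1"
    have xS: "x \<in> S" and xG: "x \<in> carrier G" using x L1S SG by auto
    have "comm x y \<in> L" if y: "y \<in> M" for y
    proof -
      have "y \<in> L <#> S" using y S(2) by blast
      then obtain l s where l: "l \<in> L" and s: "s \<in> S" and y_eq: "y = l \<otimes> s" unfolding set_mult_def by blast
      have lG: "l \<in> carrier G" and sG: "s \<in> carrier G" and yG: "y \<in> carrier G"
        using l s y subgroup.mem_carrier[OF sL] SG subgroup.mem_carrier[OF sM] by blast+
      have "s = inv l \<otimes> y" using y_eq lG sG by (simp add: inv_mult_cancel)
      moreover have "inv l \<in> M" using l M(2) subgroup.m_inv_closed[OF sM] by blast
      ultimately have sM': "s \<in> M" using y subgroup.m_closed[OF sM] by blast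
      have "s \<otimes> inv x \<otimes> inv s \<in> L1"
        using S.normal_inv_iff[of L1] L1(1) s subgroup.m_inv_closed[OF sL1 x] m_inv_consistent[OF S(1) s] by auto
      then have "x \<otimes> (s \<otimes> inv x \<otimes> inv s) \<in> L1" using x subgroup.m_closed[OF sL1] by blast
      then have "comm x s \<in> L1" using xG sG by (simp add: m_assoc)
      moreover have "x \<otimes> s \<otimes> inv x \<in> M" using normal.inv_op_closed2[OF M(1) xG sM'] .
      then have "comm x s \<in> M"
        using subgroup.m_closed[OF sM _ subgroup.m_inv_closed[OF sM sM']] by blast
      ultimately have "comm x s \<in> L" using L1M by blast
      moreover have "x \<otimes> l \<otimes> inv x \<in> L" using normal.inv_op_closed2[OF L(1) xG l] .
      ultimately have "(x \<otimes> l \<otimes> inv x) \<otimes> comm x s \<otimes> inv l \<in> L"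
        using l subgroup.m_closed[OF sL] subgroup.m_inv_closed[OF sL] by blast
      moreover have "(x \<otimes> l \<otimes> inv x) \<otimes> comm x s \<otimes> inv l = comm x y"
        unfolding y_eq using xG lG sG by (simp add: m_assoc inv_mult_cancel inv_mult_group)
      ultimately show ?thesis by simp
    qed
    then show "x \<in> centralizer_mod G L M" using xG unfolding centralizer_mod_def by blast
  qed
  also have "\<dots> \<subseteq> M" by (rule hall_higman[OF solv p K L M(1,2,4)])
  finally have "L1 \<subseteq> M" .
  let ?SM = "S \<inter> M" and ?P = "M1 <#>\<^bsub>G\<lparr>carrier := S\<rparr>\<^esub> (S \<inter> M)"
  have SM: "?SM \<lhd> G\<lparr>carrier := S\<rparr>" by (rule Int_normal_restrict[OF S(1) M(1)])
  have P: "?P \<lhd> G\<lparr>carrier := S\<rparr>" by (rule S.normal_mult[OF M1(1) SM])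
  have "prime_height_le (G\<lparr>carrier := S\<rparr>) r n M1"
    by (rule S.height_le_imp_prime_height_le[OF r(1) M1(4)])
  then have 2: "prime_height_le (G\<lparr>carrier := S\<rparr>) r n ?P"
    by (rule S.prime_height_le_normal_mono[OF M1(1) P S.subset_mult_left_normal[OF M1(1) SM]])
  have "L1 \<subseteq> M1 \<inter> ?SM" using L1(3) L1S \<open>L1 \<subseteq> M\<close> by blast
  then have "pi_section {p} (M1 \<inter> ?SM) M1"
    using S.pi_section_trans_normal[OF L1(1) S.normal_Int[OF M1(1) SM] M1(1), of "{p}"] L1(5) by simp
  then have "pi_section {p} ?SM ?P"
    using S.pi_section_mult_iff(2)[OF M1(1) normal_imp_subgroup[OF SM]] by simp
  then have "pi_section (- {r}) ?SM ?P" by (rule S.pi_section_mono) (use r(2) in auto)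
  from S.prime_height_le_extend[OF SM P S.subset_mult_right_normal[OF M1(1) SM] this 2]
  show ?thesis .
qed

lemma height_le_carrier: "height_le G n (carrier G)"
proof (induction n)
  case (Suc n)
  have "nil_section G (carrier G) (carrier G)"
    unfolding nil_section_def using complemented_section_refl[OF normal_self] by blast
  then show ?case using Suc normal_self by auto
qed simp

end

section \<open>Words of primes and their restrictions\<close>

definition runs :: "nat set \<Rightarrow> nat list \<Rightarrow> nat" where
  "runs \<sigma> w = length (remdups_adj (filter (\<lambda>p. p \<in> \<sigma>) w))"

lemma runs_Cons_Cons_ge:
  assumes "x \<noteq> y"
  shows "runs \<sigma> (y # w) - 1 + (if x \<in> \<sigma> \<and> y \<in> \<sigma> then 1 else 0) \<le> runs \<sigma> (x # y # w) - 1"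
proof -
  have "length (remdups_adj zs) \<le> length (remdups_adj (z # zs))" for z :: nat and zs
    by (cases zs) auto
  moreover have "length (remdups_adj (z # zs)) > 0" for z :: nat and zs
    using remdups_adj_length_ge1[of "z # zs"] by simp
  ultimately show ?thesis using assms unfolding runs_def by (auto simp: Suc_le_eq diff_le_mono)
qed

text \<open>Every letter lies in at least two of the three sets, so any two neighbouring letters lie
together in one of them.\<close>

lemma length_le_sum_runs:
  assumes "distinct_adj w" "set w \<subseteq> \<sigma> \<union> \<tau>" "set w \<subseteq> \<tau> \<union> \<upsilon>" "set w \<subseteq> \<upsilon> \<union> \<sigma>"
  shows "length w - 1 \<le> (runs \<sigma> w - 1) + (runs \<tau> w - 1) + (runs \<upsilon> w - 1)"
  using assms
proof (induction w rule: induct_list012)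
  case (3 x y w)
  then have IH: "length (y # w) - 1 \<le> (runs \<sigma> (y # w) - 1) + (runs \<tau> (y # w) - 1) + (runs \<upsilon> (y # w) - 1)"
    and xy: "x \<noteq> y" by auto
  define kept where "kept \<rho> = (if x \<in> \<rho> \<and> y \<in> \<rho> then 1 else 0 :: nat)" for \<rho>
  have "kept \<sigma> + kept \<tau> + kept \<upsilon> \<ge> 1" unfolding kept_def using 3 by auto
  moreover have "runs \<rho> (y # w) - 1 + kept \<rho> \<le> runs \<rho> (x # y # w) - 1" for \<rho>
    using runs_Cons_Cons_ge[OF xy] unfolding kept_def .
  from this[of \<sigma>] this[of \<tau>] this[of \<upsilon>]
  have "(runs \<sigma> (y # w) - 1) + (runs \<tau> (y # w) - 1) + (runs \<upsilon> (y # w) - 1) + (kept \<sigma> + kept \<tau> + kept \<upsilon>)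
      \<le> (runs \<sigma> (x # y # w) - 1) + (runs \<tau> (x # y # w) - 1) + (runs \<upsilon> (x # y # w) - 1)"
    by linarith
  moreover have "length (x # y # w) - 1 = length (y # w) - 1 + 1" by simp
  ultimately show ?case using IH by linarith
qed auto

context finite_group
begin

lemma hall_subgroup_section:
  assumes "hall_subgroup G \<sigma> S" shows "subgroup S G" "pi_section (- \<sigma>) S (carrier G)"
proof -
  show S: "subgroup S G" using assms unfolding hall_subgroup_def by simp
  have "card (rcosets S) * card S = card (carrier G)" using lagrange[OF S] by (simp add: order_def)
  then have "card (carrier G) div card S = card (rcosets S)"
    using card_pos[OF S] by (metis nonzero_mult_div_cancel_right less_numeral_extra(3))
  then show "pi_section (- \<sigma>) S (carrier G)"
    using assms unfolding hall_subgroup_def pi_section_def by auto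
qed

text \<open>\<open>|MS : LS|\<close> divides \<open>|M : L|\<close>, whose only prime is \<open>p\<close>, and also \<open>|G : S|\<close>, which is not divisible
by \<open>p\<close>.\<close>

lemma hall_covers_primary:
  assumes "hall_subgroup G \<sigma> S" "p \<in> \<sigma>" "L \<lhd> G" "M \<lhd> G" "L \<subseteq> M" "pi_section {p} L M"
  shows "M \<subseteq> L <#> S"
proof -
  note S = hall_subgroup_section[OF assms(1)]
  have sM: "subgroup M G" and sL: "subgroup L G" using normal_imp_subgroup assms(3,4) by blast+
  define T where "T = L <#> S"
  have T: "subgroup T G" unfolding T_def by (rule mult_subgroup[OF assms(3) S(1)])
  have LT: "L \<subseteq> T" "S \<subseteq> T"
    unfolding T_def by (rule subset_mult_left[OF sL S(1)], rule subset_mult_right[OF sL S(1)])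
  have sI: "subgroup (M \<inter> T) G" by (rule subgroups_Inter_pair[OF sM T])
  have "pi_section {p} (M \<inter> T) M"
    using pi_section_trans[OF sL sI sM, of "{p}"] assms(5,6) LT by simp
  then have 1: "pi_section {p} T (M <#> T)" using pi_section_mult_iff(2)[OF assms(4) T] by simp
  have MT: "subgroup (M <#> T) G" "T \<subseteq> M <#> T" "M \<subseteq> M <#> T"
    by (rule mult_subgroup[OF assms(4) T], rule subset_mult_right[OF sM T], rule subset_mult_left[OF sM T])
  have "pi_section (- \<sigma>) T (carrier G)"
    using pi_section_trans[OF S(1) T subgroup_self LT(2) subgroup.subset[OF T]] S(2) by simp
  then have "pi_section (- \<sigma>) T (M <#> T)"
    using pi_section_trans[OF T MT(1) subgroup_self MT(2) subgroup.subset[OF MT(1)]] by simp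
  from pi_section_both[OF 1 this] have "pi_section {} T (M <#> T)" using assms(2) by simp
  then have "T = M <#> T" using pi_section_empty[OF T MT(1,2)] by simp
  then show ?thesis using MT(3) unfolding T_def by simp
qed

lemma hall_meets_prime:
  assumes "hall_subgroup G \<sigma> S" "p \<in> \<sigma>" "K \<lhd> G" "\<not> pi_section (- {p}) K (carrier G)"
  shows "\<not> pi_section (- {p}) (S \<inter> K) S"
proof
  note S = hall_subgroup_section[OF assms(1)]
  have sK: "subgroup K G" by (rule normal_imp_subgroup[OF assms(3)])
  have T: "subgroup (K <#> S) G" by (rule mult_subgroup[OF assms(3) S(1)])
  assume "pi_section (- {p}) (S \<inter> K) S"
  then have "pi_section (- {p}) K (K <#> S)"
    using pi_section_mult_iff(1)[OF assms(3) S(1)] by (simp add: Int_commute)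
  moreover have "pi_section (- \<sigma>) (K <#> S) (carrier G)"
    using pi_section_trans[OF S(1) T subgroup_self subset_mult_right[OF sK S(1)] subgroup.subset[OF T]] S(2)
    by simp
  then have "pi_section (- {p}) (K <#> S) (carrier G)"
    by (rule pi_section_mono) (use assms(2) in auto)
  ultimately show False
    using pi_section_trans[OF sK T subgroup_self subset_mult_left[OF sK S(1)] subgroup.subset[OF T]] assms(4)
    by simp
qed

lemma not_pi_section_dvd:
  assumes "K \<lhd> G" "\<not> pi_section (- {q}) K (carrier G)" shows "q dvd order G"
proof -
  have "q dvd card (carrier G) div card K" using assms(2) unfolding pi_section_def by auto
  moreover have "card K dvd card (carrier G)"
    using subgroup_card_dvd[OF normal_imp_subgroup[OF assms(1)] subgroup_self normal_subset_carrier[OF assms(1)]] .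
  ultimately show ?thesis unfolding order_def by (metis dvd_div_mult_self dvd_mult2)
qed

text \<open>The word is read from the bottom of \<open>G / K\<close> upwards.  Its first letter is the prime \<open>q\<close> at
which the length exceeds \<open>n\<close>; the remaining letters come from the quotient by \<open>O\<^bsub>q'q\<^esub>(G / K)\<close>,
in which \<open>O\<^sub>q\<close> is trivial, so that a prime \<open>r \<noteq> q\<close> is available for the next letter.
For a Hall subgroup the claim concerns the length at the first letter that survives, because
only this refinement propagates: a letter \<open>q\<close> in front of a different letter adds a run and, by
\<open>prime_height_le_strip_primary\<close>, a unit of length.\<close>

lemma prime_word_exists:
  assumes solv: "solvable G" and "K \<lhd> G" "prime q" "\<not> prime_height_le G q n K"
  shows "\<exists>w. length w = Suc n \<and> hd w = q \<and> distinct_adj w \<and>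
    (\<forall>\<sigma> S. hall_subgroup G \<sigma> S \<and> filter (\<lambda>p. p \<in> \<sigma>) w \<noteq> [] \<longrightarrow>
      \<not> prime_height_le (G\<lparr>carrier := S\<rparr>) (hd (filter (\<lambda>p. p \<in> \<sigma>) w)) (runs \<sigma> w - 1) (S \<inter> K)) \<and>
    (\<forall>p\<in>set w. prime p \<and> p dvd order G)"
  using assms(2-4)
proof (induction n arbitrary: K q)
  case 0
  then have q: "\<not> pi_section (- {q}) K (carrier G)" by simp
  have "q dvd order G" using not_pi_section_dvd[OF 0(1) q] .
  moreover have "\<not> prime_height_le (G\<lparr>carrier := S\<rparr>) q 0 (S \<inter> K)" if "hall_subgroup G \<sigma> S" "q \<in> \<sigma>" for \<sigma> S
    using hall_meets_prime[OF that 0(1) q] by simp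
  ultimately show ?case using 0(2) by (intro exI[of _ "[q]"]) (auto simp: runs_def)
next
  case (Suc n)
  note K = Suc.prems(1) and q = Suc.prems(2)
  obtain L where L: "L \<lhd> G" "K \<subseteq> L" "L \<subseteq> carrier G" "pi_section (- {q}) K L"
    "\<And>N. N \<lhd> G \<Longrightarrow> K \<subseteq> N \<Longrightarrow> N \<subseteq> carrier G \<Longrightarrow> pi_section (- {q}) K N \<Longrightarrow> N \<subseteq> L"
    by (rule greatest_pi_section[where \<pi> = "- {q}", OF K normal_subset_carrier[OF K] normal_self])
      (rule that, assumption+)
  have Lmax: "N \<subseteq> L" if "N \<lhd> G" "K \<subseteq> N" "pi_section (- {q}) K N" for N
    using L(5)[OF that(1,2) normal_subset_carrier[OF that(1)] that(3)] .
  obtain M where M: "M \<lhd> G" "L \<subseteq> M" "M \<subseteq> carrier G" "pi_section {q} L M"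
    "\<And>N. N \<lhd> G \<Longrightarrow> L \<subseteq> N \<Longrightarrow> N \<subseteq> carrier G \<Longrightarrow> pi_section {q} L N \<Longrightarrow> N \<subseteq> M"
    by (rule greatest_pi_section[where \<pi> = "{q}", OF L(1,3) normal_self]) (rule that, assumption+)
  have Mmax: "N \<subseteq> M" if "N \<lhd> G" "L \<subseteq> N" "pi_section {q} L N" for N
    using M(5)[OF that(1,2) normal_subset_carrier[OF that(1)] that(3)] .
  have KM: "K \<subseteq> M" using L(2) M(2) by blast
  have "complemented_section G q K M" unfolding complemented_section_def using L M(2,4) by blast
  then have "\<not> height_le G n M" using Suc.prems(3) M(1) KM by auto
  moreover have "N = M" if N: "N \<lhd> G" "M \<subseteq> N" "pi_section (- (- {q})) M N" for N
  proof -
    have "pi_section {q} L N"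
      using pi_section_trans_normal[OF L(1) M(1) N(1) M(2) N(2)] M(4) N(3) by simp
    then show ?thesis using Mmax[OF N(1)] M(2) N(2) by blast
  qed
  \<comment> \<open>Any prime other than \<open>q\<close> will do: it only certifies that \<open>- {q}\<close> contains a prime.\<close>
  moreover obtain q' :: nat where "prime q'" "q' > q" using bigger_prime by blast
  ultimately obtain r where r: "r \<in> - {q}" "prime r" "\<not> prime_height_le G r n M"
    using height_le_from_primes[OF M(1), of "- {q}" n] by (metis ComplI less_irrefl singletonD)
  obtain w where w: "length w = Suc n" "hd w = r" "distinct_adj w"
    "\<And>\<sigma> S. hall_subgroup G \<sigma> S \<Longrightarrow> filter (\<lambda>p. p \<in> \<sigma>) w \<noteq> [] \<Longrightarrow>
      \<not> prime_height_le (G\<lparr>carrier := S\<rparr>) (hd (filter (\<lambda>p. p \<in> \<sigma>) w)) (runs \<sigma> w - 1) (S \<inter> M)"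
    "\<And>p. p \<in> set w \<Longrightarrow> prime p \<and> p dvd order G"
    using Suc.IH[OF M(1) r(2,3)] by blast
  \<comment> \<open>Needed when no letter of \<open>w\<close> survives in \<open>\<sigma>\<close>: then the single run consists of \<open>q\<close>.\<close>
  have qd: "\<not> pi_section (- {q}) K (carrier G)"
  proof
    assume "pi_section (- {q}) K (carrier G)"
    then have "complemented_section G q K (carrier G)"
      unfolding complemented_section_def
      using normal_self normal_subset_carrier[OF K] pi_section_refl[OF subgroup_self] by blast
    then have "prime_height_le G q (Suc n) K"
      using normal_self normal_subset_carrier[OF K] height_le_carrier[of n] by auto
    then show False using Suc.prems(3) by blast
  qed
  have "q dvd order G" using not_pi_section_dvd[OF K qd] .
  have main: "\<not> prime_height_le (G\<lparr>carrier := S\<rparr>) (hd (filter (\<lambda>p. p \<in> \<sigma>) (q # w))) (runs \<sigma> (q # w) - 1) (S \<inter> K)"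
    if S: "hall_subgroup G \<sigma> S" and ne: "filter (\<lambda>p. p \<in> \<sigma>) (q # w) \<noteq> []" for \<sigma> S
  proof -
    note sS = hall_subgroup_section(1)[OF S]
    interpret S: finite_group "G\<lparr>carrier := S\<rparr>" by (rule finite_group_restrict[OF sS])
    have nK: "S \<inter> K \<lhd> G\<lparr>carrier := S\<rparr>" and nM: "S \<inter> M \<lhd> G\<lparr>carrier := S\<rparr>"
      using Int_normal_restrict[OF sS] K M(1) by blast+
    have mono: "\<not> prime_height_le (G\<lparr>carrier := S\<rparr>) p m (S \<inter> K)"
      if "\<not> prime_height_le (G\<lparr>carrier := S\<rparr>) p m (S \<inter> M)" for p m
      using S.prime_height_le_normal_mono[OF nK nM, of p m] KM that by blast
    show ?thesis
    proof (cases "q \<in> \<sigma>")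
      case False
      then show ?thesis using ne mono[OF w(4)[OF S]] by (simp add: runs_def)
    next
      case q\<sigma>: True
      show ?thesis
      proof (cases "filter (\<lambda>p. p \<in> \<sigma>) w")
        case Nil
        then show ?thesis using q\<sigma> hall_meets_prime[OF S q\<sigma> K qd] by (simp add: runs_def)
      next
        case (Cons p ps)
        then have ih: "\<not> prime_height_le (G\<lparr>carrier := S\<rparr>) p (length (remdups_adj (p # ps)) - 1) (S \<inter> M)"
          using w(4)[OF S] by (simp add: runs_def)
        show ?thesis
        proof (cases "p = q")
          case True
          then show ?thesis using mono[OF ih] q\<sigma> Cons by (simp add: runs_def)
        next
          case False
          define m where "m = length (remdups_adj (p # ps)) - 1"
          have "p \<in> set (filter (\<lambda>p. p \<in> \<sigma>) w)" unfolding Cons by simp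
          then have "p \<in> set w" by simp
          then have "prime p" using w(5) by blast
          have "length (remdups_adj (p # ps)) > 0"
            using remdups_adj_length_ge1[of "p # ps"] by simp
          then have e: "runs \<sigma> (q # w) - 1 = Suc m" unfolding m_def using q\<sigma> Cons False by (simp add: runs_def)
          have "\<not> prime_height_le (G\<lparr>carrier := S\<rparr>) q (Suc m) (S \<inter> K)"
            using prime_height_le_strip_primary[OF solv q \<open>prime p\<close> False K L(1,2,4) Lmax M(1,2,4) Mmax sS
                hall_covers_primary[OF S q\<sigma> L(1) M(1,2,4)], of m] ih unfolding m_def by blast
          then show ?thesis unfolding e using q\<sigma> by simp
        qed
      qed
    qed
  qed
  have "distinct_adj (q # w)" using w(1,2,3) r(1) by (cases w) auto
  then show ?case using w(1,5) main q \<open>q dvd order G\<close> by (intro exI[of _ "q # w"]) auto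
qed

end

section \<open>The Fitting series\<close>

text \<open>The successor step of the Fitting series, as a function of an arbitrary normal subgroup.\<close>

definition fitting_step :: "('a, 'b) monoid_scheme \<Rightarrow> 'a set \<Rightarrow> 'a set" where
  "fitting_step G K = {x \<in> carrier G. K #>\<^bsub>G\<^esub> x \<in> fitting_subgroup (G Mod K)}"

context finite_group
begin

lemma nilpotent_group_iff_nil_section:
  assumes N: "N \<lhd> G"
  shows "nilpotent_group (G\<lparr>carrier := N\<rparr>) \<longleftrightarrow> nil_section G {\<one>} N"
proof -
  have sN: "subgroup N G" by (rule normal_imp_subgroup[OF N])
  have "rel_lcs G N n = {\<one>} \<longleftrightarrow> rel_lcs G N n \<subseteq> {\<one>}" for n
    using rel_lcs_subgroup[OF sN, of n] subgroup.one_closed by blast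
  then show ?thesis
    unfolding nilpotent_group_def lower_central_series_restrict[OF sN]
    using nil_section_iff_lcs[OF one_is_normal N] subgroup.one_closed[OF sN] subgroup_imp_group[OF sN] by simp
qed

lemma nil_section_mult2:
  assumes "K \<lhd> G" "M1 \<lhd> G" "M2 \<lhd> G" "nil_section G K M1" "nil_section G K M2"
  shows "nil_section G K (M1 <#> M2)"
  using complemented_section_mult2[OF assms(1-3)] assms(4,5) unfolding nil_section_def by blast

lemma nil_section_refl: "K \<lhd> G \<Longrightarrow> nil_section G K K"
  unfolding nil_section_def using complemented_section_refl by blast

text \<open>The largest normal nilpotent subgroup exists by Fitting's theorem; it generates the Fitting
subgroup since it is itself one of the generating subgroups.\<close>

lemma fitting_subgroup_nilpotent:
  shows "fitting_subgroup G \<lhd> G" "nil_section G {\<one>} (fitting_subgroup G)"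
    and "N \<lhd> G \<Longrightarrow> nil_section G {\<one>} N \<Longrightarrow> N \<subseteq> fitting_subgroup G"
proof -
  let ?F = "{N. N \<lhd> G \<and> nil_section G {\<one>} N}"
  have one: "{\<one>} \<in> ?F" using one_is_normal nil_section_refl by blast
  obtain M where M: "M \<in> ?F" "\<forall>N\<in>?F. M \<subseteq> N \<longrightarrow> M = N"
    using finite_has_maximal[OF finite_normals] one by blast
  have max: "N \<subseteq> M" if N: "N \<in> ?F" for N
  proof -
    have n: "N \<lhd> G" "M \<lhd> G" using N M(1) by blast+
    have "N <#> M \<in> ?F" using normal_mult[OF n] nil_section_mult2[OF one_is_normal n] N M(1) by blast
    then have "M = N <#> M" using M(2) subset_mult_right_normal[OF n] by blast
    then show ?thesis using subset_mult_left_normal[OF n] by simp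
  qed
  have "fitting_subgroup G = generate G (\<Union>?F)"
    unfolding fitting_subgroup_def using nilpotent_group_iff_nil_section
    by (intro arg_cong[where f = "\<lambda>X. generate G (\<Union>X)"] Collect_cong) blast
  also have "\<dots> = M"
  proof
    have "\<Union>?F \<subseteq> M" using max by blast
    moreover have "subgroup M G" using M(1) normal_imp_subgroup by blast
    ultimately show "generate G (\<Union>?F) \<subseteq> M" by (rule generate_subgroup_incl)
    show "M \<subseteq> generate G (\<Union>?F)" using M(1) by (blast intro: generate.incl)
  qed
  finally have eq: "fitting_subgroup G = M" .
  show "fitting_subgroup G \<lhd> G" "nil_section G {\<one>} (fitting_subgroup G)"
    using M(1) eq by simp_all
  show "N \<subseteq> fitting_subgroup G" if "N \<lhd> G" "nil_section G {\<one>} N"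
    using max that eq by simp
qed

lemma fitting_step_props:
  assumes K: "K \<lhd> G"
  shows "fitting_step G K \<lhd> G" "K \<subseteq> fitting_step G K" "nil_section G K (fitting_step G K)"
    and "N \<lhd> G \<Longrightarrow> K \<subseteq> N \<Longrightarrow> nil_section G K N \<Longrightarrow> N \<subseteq> fitting_step G K"
proof -
  interpret K: normal K G by fact
  interpret h: group_hom G "G Mod K" "(#>) K" by (rule K.mod_hom)
  interpret Q: finite_group "G Mod K" by (rule finite_group_Mod[OF K])
  let ?Fit = "fitting_subgroup (G Mod K)" and ?F = "fitting_step G K"
  note Fit = Q.fitting_subgroup_nilpotent
  show F: "?F \<lhd> G" unfolding fitting_step_def by (rule h.preimage_normal[OF Fit(1)])
  show KF: "K \<subseteq> ?F"
  proof
    fix x assume x: "x \<in> K"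
    then have "K #> x = K" using K.coset_eq_iff by simp
    moreover have "K \<in> ?Fit" using subgroup.one_closed[OF normal_imp_subgroup[OF Fit(1)]] by simp
    ultimately show "x \<in> ?F" unfolding fitting_step_def using x by simp
  qed
  have sF: "subgroup ?F G" by (rule normal_imp_subgroup[OF F])
  have sFit: "subgroup ?Fit (G Mod K)" by (rule normal_imp_subgroup[OF Fit(1)])
  obtain n where n: "rel_lcs (G Mod K) ?Fit n \<subseteq> {K}"
    using Q.nil_section_imp_lcs[OF h.H.one_is_normal Fit(1) _ Fit(2)] subgroup.one_closed[OF sFit] by auto
  have "(#>) K ` ?F \<subseteq> ?Fit" unfolding fitting_step_def by blast
  then have "(#>) K ` rel_lcs G ?F n \<subseteq> {K}"
    using h.H.rel_lcs_mono[of "(#>) K ` ?F" ?Fit n] sFit n h.rel_lcs_img[OF sF, of n] by simp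
  moreover have "x \<in> carrier G" if "x \<in> rel_lcs G ?F n" for x
    using rel_lcs_subgroup[OF sF, of n] subgroup.mem_carrier[OF sF] that by blast
  ultimately have "x \<in> K" if "x \<in> rel_lcs G ?F n" for x
    using K.coset_eq_iff[of x] that by blast
  then have "rel_lcs G ?F n \<subseteq> K" by blast
  then show "nil_section G K ?F" using nil_section_iff_lcs[OF K F KF] by blast
  show "N \<subseteq> ?F" if N: "N \<lhd> G" "K \<subseteq> N" "nil_section G K N"
  proof -
    have sN: "subgroup N G" by (rule normal_imp_subgroup[OF N(1)])
    obtain n where n: "rel_lcs G N n \<subseteq> K" using nil_section_imp_lcs[OF K N] by blast
    have img: "(#>) K ` N \<lhd> G Mod K"
      using normal.surj_hom_normal_subgroup[OF N(1) K.mod_hom] by (simp add: carrier_FactGroup)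
    have "rel_lcs (G Mod K) ((#>) K ` N) n \<subseteq> {K}"
    proof -
      have "K #> x = K" if x: "x \<in> rel_lcs G N n" for x
      proof -
        have "x \<in> K" using n x by (rule subsetD)
        then show ?thesis using K.coset_eq_iff[of x] by simp
      qed
      then show ?thesis unfolding h.rel_lcs_img[OF sN] by blast
    qed
    then have "nil_section (G Mod K) {\<one>\<^bsub>G Mod K\<^esub>} ((#>) K ` N)"
      using Q.nil_section_iff_lcs[OF h.H.one_is_normal img]
        subgroup.one_closed[OF normal_imp_subgroup[OF img]] by auto
    then have "(#>) K ` N \<subseteq> ?Fit" by (rule Fit(3)[OF img])
    then show ?thesis unfolding fitting_step_def using subgroup.mem_carrier[OF sN] by blast
  qed
qed

lemma fitting_series_Suc: "fitting_series G (Suc n) = fitting_step G (fitting_series G n)"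
  by (simp add: fitting_step_def)

lemma fitting_series_normal: "fitting_series G n \<lhd> G"
proof (induction n)
  case (Suc n)
  then show ?case unfolding fitting_series_Suc by (rule fitting_step_props(1))
qed (simp add: one_is_normal)

text \<open>The Fitting series ascends at least as fast as any normal series with nilpotent factors.\<close>

lemma height_le_imp_fitting_series:
  assumes "K \<lhd> G" "K \<subseteq> fitting_series G i" "height_le G n K"
  shows "fitting_series G (i + n) = carrier G"
  using assms
proof (induction n arbitrary: i K)
  case 0
  then show ?case using normal_subset_carrier[OF fitting_series_normal[of i]] by simp
next
  case (Suc n)
  let ?F = "fitting_series G i"
  have F: "?F \<lhd> G" by (rule fitting_series_normal)
  obtain M where M: "M \<lhd> G" "K \<subseteq> M" "nil_section G K M" "height_le G n M" using Suc.prems(3) by auto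
  have MF: "M <#> ?F \<lhd> G" by (rule normal_mult[OF M(1) F])
  have "K <#> ?F = ?F" by (rule mult_absorb_normal[OF Suc.prems(1) F Suc.prems(2)])
  then have "nil_section G ?F (M <#> ?F)"
    using complemented_section_mult[OF Suc.prems(1) M(1) F] M(3) unfolding nil_section_def by simp
  then have "M <#> ?F \<subseteq> fitting_series G (Suc i)"
    unfolding fitting_series_Suc
    by (rule fitting_step_props(4)[OF F MF subset_mult_right_normal[OF M(1) F]])
  then have "M \<subseteq> fitting_series G (Suc i)" using subset_mult_left_normal[OF M(1) F] by blast
  from Suc.IH[OF M(1) this M(4)] show ?case by simp
qed

lemma fitting_series_imp_height_le:
  assumes "fitting_series G (n + j) = carrier G"
  shows "height_le G n (fitting_series G j)"
  using assms
proof (induction n arbitrary: j)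
  case (Suc n)
  then have "fitting_series G (n + Suc j) = carrier G" by (simp only: add_Suc add_Suc_right)
  then have "height_le G n (fitting_series G (Suc j))" by (rule Suc.IH)
  then show ?case
    using fitting_step_props[OF fitting_series_normal[of j]] unfolding height_le.simps fitting_series_Suc by blast
qed simp

lemma height_le_mono:
  assumes "K \<lhd> G" "height_le G n K" "n \<le> m"
  shows "height_le G m K"
  using assms(3)
proof (induction m rule: dec_induct)
  case (step m)
  then show ?case using assms(1) nil_section_refl[OF assms(1)] by auto
qed (rule assms(2))

lemma solvable_imp_height_le:
  assumes "solvable G" shows "\<exists>n. height_le G n {\<one>}"
proof -
  let ?D = "\<lambda>i. (derived G ^^ i) (carrier G)"
  obtain n where n: "?D n = {\<one>}" using assms solvable_iff_trivial_derived_seq by blast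
  have D: "?D i \<lhd> G" for i
    by (induction i) (use normal_self derived_is_normal in auto)
  have "height_le G i (?D i)" for i
  proof (induction i)
    case (Suc i)
    have s: "subgroup (?D i) G" by (rule normal_imp_subgroup[OF D])
    have sub: "?D (Suc i) \<subseteq> ?D i" using derived_incl[OF subset_refl s] by simp
    have "rel_lcs G (?D i) (Suc 0) \<subseteq> ?D (Suc i)"
    proof (rule rel_lcs_Suc_subset[OF normal_imp_subgroup[OF D]])
      show "rel_lcs G (?D i) 0 \<subseteq> ?D i" by simp
      fix x y assume xy: "x \<in> ?D i" "y \<in> ?D i"
      show "comm x y \<in> ?D (Suc i)" using comm_mem_derived[OF xy] by simp
    qed
    then have "nil_section G (?D (Suc i)) (?D i)" using nil_section_iff_lcs[OF D D sub] by blast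
    then show ?case using Suc D[of i] sub unfolding height_le.simps by blast
  qed simp
  then show ?thesis using n by metis
qed

text \<open>Solubility guarantees that the Fitting series reaches \<open>G\<close>, without which the least index in
the definition of the Fitting length would carry no information.\<close>

lemma fitting_length_le_iff:
  assumes "solvable G"
  shows "fitting_length G \<le> n \<longleftrightarrow> height_le G n {\<one>}"
proof
  assume "height_le G n {\<one>}"
  then have "fitting_series G n = carrier G"
    using height_le_imp_fitting_series[OF one_is_normal, of 0 n] by simp
  then show "fitting_length G \<le> n" unfolding fitting_length_def by (rule Least_le)
next
  assume le: "fitting_length G \<le> n"
  obtain m where "height_le G m {\<one>}" using solvable_imp_height_le[OF assms] by blast
  then have "fitting_series G m = carrier G"
    using height_le_imp_fitting_series[OF one_is_normal, of 0 m] by simp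
  then have "fitting_series G (fitting_length G) = carrier G"
    unfolding fitting_length_def by (rule LeastI)
  then have "height_le G (fitting_length G) {\<one>}"
    using fitting_series_imp_height_le[of "fitting_length G" 0] by simp
  then show "height_le G n {\<one>}" using height_le_mono[OF one_is_normal _ le] by blast
qed

lemma solvable_restrict:
  assumes "solvable G" "subgroup S G" shows "solvable (G\<lparr>carrier := S\<rparr>)"
proof -
  interpret S: group "G\<lparr>carrier := S\<rparr>" by (rule subgroup_imp_group[OF assms(2)])
  have "group_hom (G\<lparr>carrier := S\<rparr>) G (\<lambda>x. x)"
    by unfold_locales (auto intro!: homI subgroup.mem_carrier[OF assms(2)])
  from group_hom.inj_hom_imp_solvable[OF this _ assms(1)] show ?thesis by simp
qed

text \<open>The prime \<open>p\<close> serves only to make \<open>S\<close> nontrivial; this is what gives the bound for a word with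
no letter in \<open>\<sigma>\<close>.\<close>

lemma hall_fitting_length_bound:
  assumes solv: "solvable G" and S: "hall_subgroup G \<sigma> S" and p: "p \<in> \<sigma>" "prime p" "p dvd order G"
    and w: "\<And>r. r \<in> set w \<Longrightarrow> prime r"
      "filter (\<lambda>p. p \<in> \<sigma>) w \<noteq> [] \<Longrightarrow>
        \<not> prime_height_le (G\<lparr>carrier := S\<rparr>) (hd (filter (\<lambda>p. p \<in> \<sigma>) w)) (runs \<sigma> w - 1) {\<one>}"
  shows "0 < fitting_length (G\<lparr>carrier := S\<rparr>)" "runs \<sigma> w - 1 < fitting_length (G\<lparr>carrier := S\<rparr>)"
proof -
  let ?S = "G\<lparr>carrier := S\<rparr>"
  have sS: "subgroup S G" by (rule hall_subgroup_section(1)[OF S])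
  interpret S: finite_group ?S by (rule finite_group_restrict[OF sS])
  have less: "n < fitting_length ?S" if "prime r" "\<not> prime_height_le ?S r n {\<one>}" for r n
  proof -
    have "\<not> height_le ?S n {\<one>}" using that S.height_le_imp_prime_height_le by blast
    then show ?thesis
      using S.fitting_length_le_iff[OF solvable_restrict[OF solv sS], of n] by simp
  qed
  have "\<not> pi_section (- {p}) {\<one>} (carrier G)"
    using p(2,3) unfolding pi_section_def order_def by auto
  from hall_meets_prime[OF S p(1) one_is_normal this]
  have "\<not> prime_height_le ?S p 0 {\<one>}" using subgroup.one_closed[OF sS] by simp
  from less[OF p(2) this] show pos: "0 < fitting_length ?S" .
  show "runs \<sigma> w - 1 < fitting_length ?S"
  proof (cases "filter (\<lambda>p. p \<in> \<sigma>) w = []")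
    case True
    then show ?thesis using pos by (simp add: runs_def)
  next
    case False
    then have "hd (filter (\<lambda>p. p \<in> \<sigma>) w) \<in> set (filter (\<lambda>p. p \<in> \<sigma>) w)" by (rule hd_in_set)
    then have "prime (hd (filter (\<lambda>p. p \<in> \<sigma>) w))" using w(1) by simp
    then show ?thesis using less w(2)[OF False] by blast
  qed
qed

text \<open>Each set has to meet \<open>\<pi>(G)\<close>: if \<open>\<sigma>\<close> missed it, then \<open>S\<close> would be trivial and \<open>T\<close> and \<open>U\<close> would be
\<open>G\<close>, and the inequality would fail for every nontrivial nilpotent \<open>G\<close>.\<close>

lemma fitting_length_hall_bound:
  assumes solv: "solvable G"
    and cover: "prime_divisors_of_order G \<subseteq> \<sigma> \<union> \<tau>" "prime_divisors_of_order G \<subseteq> \<tau> \<union> \<upsilon>"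
      "prime_divisors_of_order G \<subseteq> \<upsilon> \<union> \<sigma>"
    and meet: "\<sigma> \<inter> prime_divisors_of_order G \<noteq> {}" "\<tau> \<inter> prime_divisors_of_order G \<noteq> {}"
      "\<upsilon> \<inter> prime_divisors_of_order G \<noteq> {}"
    and hall: "hall_subgroup G \<sigma> S" "hall_subgroup G \<tau> T" "hall_subgroup G \<upsilon> U"
  shows "fitting_length G + 2 \<le> fitting_length (G\<lparr>carrier := S\<rparr>)
    + fitting_length (G\<lparr>carrier := T\<rparr>) + fitting_length (G\<lparr>carrier := U\<rparr>)"
proof -
  define n where "n = fitting_length G - 1"
  obtain p where p: "prime p" "p dvd order G" using meet(1) unfolding prime_divisors_of_order_def by blast
  have "order G \<noteq> 1" using p by auto
  then have "carrier G \<noteq> {\<one>}" unfolding order_def by force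
  then have "\<not> height_le G 0 {\<one>}" by simp
  then have "\<not> fitting_length G \<le> 0" using fitting_length_le_iff[OF solv] by blast
  then have n: "fitting_length G = Suc n" unfolding n_def by simp
  then have "\<not> height_le G n {\<one>}" using fitting_length_le_iff[OF solv, of n] by simp
  moreover have "N = {\<one>}" if "N \<lhd> G" "{\<one>} \<subseteq> N" "pi_section (- UNIV) {\<one>} N" for N
    using pi_section_empty[OF triv_subgroup normal_imp_subgroup[OF that(1)] that(2)] that(3) by simp
  ultimately obtain q where q: "prime q" "\<not> prime_height_le G q n {\<one>}"
    using height_le_from_primes[OF one_is_normal, of UNIV n] p(1) by blast
  from prime_word_exists[OF solv one_is_normal q]
  obtain w where w: "length w = Suc n" "distinct_adj w"
    "\<And>\<sigma> S. hall_subgroup G \<sigma> S \<Longrightarrow> filter (\<lambda>p. p \<in> \<sigma>) w \<noteq> [] \<Longrightarrow>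
      \<not> prime_height_le (G\<lparr>carrier := S\<rparr>) (hd (filter (\<lambda>p. p \<in> \<sigma>) w)) (runs \<sigma> w - 1) (S \<inter> {\<one>})"
    "\<And>p. p \<in> set w \<Longrightarrow> prime p \<and> p dvd order G"
    by blast
  have bound: "runs \<rho> w - 1 < fitting_length (G\<lparr>carrier := H\<rparr>)"
    if H: "hall_subgroup G \<rho> H" and m: "\<rho> \<inter> prime_divisors_of_order G \<noteq> {}" for \<rho> H
  proof -
    obtain p where p: "p \<in> \<rho>" "prime p" "p dvd order G"
      using m unfolding prime_divisors_of_order_def by blast
    have "H \<inter> {\<one>} = {\<one>}" using subgroup.one_closed[OF hall_subgroup_section(1)[OF H]] by blast
    then show ?thesis
      using hall_fitting_length_bound(2)[OF solv H p, of w] w(3)[OF H] w(4) by simp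
  qed
  have "set w \<subseteq> prime_divisors_of_order G" using w(4) unfolding prime_divisors_of_order_def by blast
  then have "length w - 1 \<le> (runs \<sigma> w - 1) + (runs \<tau> w - 1) + (runs \<upsilon> w - 1)"
    using length_le_sum_runs[OF w(2), of \<sigma> \<tau> \<upsilon>] cover by blast
  then show ?thesis
    using bound[OF hall(1) meet(1)] bound[OF hall(2) meet(2)] bound[OF hall(3) meet(3)] w(1) n by linarith
qed

end

section \<open>Fitting length and three Hall subgroups\<close>

theorem theoremA:
  fixes G :: "('a, 'b) monoid_scheme"
  assumes "group G" and "finite (carrier G)" and "solvable G"
  shows
    "(\<forall>\<sigma> \<tau> \<upsilon> S T U.
        \<sigma> \<subseteq> prime_divisors_of_order G \<and>
        \<tau> \<subseteq> prime_divisors_of_order G \<and>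
        \<upsilon> \<subseteq> prime_divisors_of_order G \<and>
        \<sigma> \<noteq> \<tau> \<and> \<tau> \<noteq> \<upsilon> \<and> \<upsilon> \<noteq> \<sigma> \<and>
        \<sigma> \<union> \<tau> = prime_divisors_of_order G \<and>
        \<tau> \<union> \<upsilon> = prime_divisors_of_order G \<and>
        \<upsilon> \<union> \<sigma> = prime_divisors_of_order G \<and>
        hall_subgroup G \<sigma> S \<and> hall_subgroup G \<tau> T \<and> hall_subgroup G \<upsilon> U \<longrightarrow>
        int (fitting_length G) \<le>
          int (fitting_length (G\<lparr>carrier := S\<rparr>)) + int (fitting_length (G\<lparr>carrier := T\<rparr>))
          + int (fitting_length (G\<lparr>carrier := U\<rparr>)) - 2) \<and>
     (\<forall>p q P Q R.
        p \<in> prime_divisors_of_order G \<and> q \<in> prime_divisors_of_order G \<and> p \<noteq> q \<and>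
        hall_subgroup G (prime_divisors_of_order G - {p}) P \<and>
        hall_subgroup G (prime_divisors_of_order G - {q}) Q \<and>
        hall_subgroup G {p, q} R \<longrightarrow>
        int (fitting_length G) \<le>
          int (fitting_length (G\<lparr>carrier := P\<rparr>)) + int (fitting_length (G\<lparr>carrier := Q\<rparr>))
          + int (fitting_length (G\<lparr>carrier := R\<rparr>)) - 2)"
proof -
  interpret finite_group G
    using assms(1,2) by (simp add: finite_group_def finite_group_axioms_def)
  let ?\<pi> = "prime_divisors_of_order G"
  have bound: "int (fitting_length G) \<le>
      int (fitting_length (G\<lparr>carrier := S\<rparr>)) + int (fitting_length (G\<lparr>carrier := T\<rparr>))
      + int (fitting_length (G\<lparr>carrier := U\<rparr>)) - 2"
    if "\<sigma> \<union> \<tau> = ?\<pi>" "\<tau> \<union> \<upsilon> = ?\<pi>" "\<upsilon> \<union> \<sigma> = ?\<pi>" "\<sigma> \<noteq> \<tau>" "\<tau> \<noteq> \<upsilon>" "\<upsilon> \<noteq> \<sigma>"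
      "hall_subgroup G \<sigma> S" "hall_subgroup G \<tau> T" "hall_subgroup G \<upsilon> U" for \<sigma> \<tau> \<upsilon> S T U
  proof -
    \<comment> \<open>If one of the sets were empty, the other two would both be \<open>\<pi>(G)\<close>.\<close>
    have "\<sigma> \<inter> ?\<pi> \<noteq> {}" "\<tau> \<inter> ?\<pi> \<noteq> {}" "\<upsilon> \<inter> ?\<pi> \<noteq> {}" using that(1-6) by blast+
    then show ?thesis
      using fitting_length_hall_bound[OF assms(3), of \<sigma> \<tau> \<upsilon> S T U] that by simp
  qed
  show ?thesis
  proof (intro conjI allI impI; elim conjE)
    fix p q P Q R
    assume pq: "p \<in> ?\<pi>" "q \<in> ?\<pi>" "p \<noteq> q"
      and hall: "hall_subgroup G (?\<pi> - {p}) P" "hall_subgroup G (?\<pi> - {q}) Q" "hall_subgroup G {p, q} R"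
    show "int (fitting_length G) \<le>
        int (fitting_length (G\<lparr>carrier := P\<rparr>)) + int (fitting_length (G\<lparr>carrier := Q\<rparr>))
        + int (fitting_length (G\<lparr>carrier := R\<rparr>)) - 2"
      by (rule bound[OF _ _ _ _ _ _ hall]) (use pq in blast)+
  qed (rule bound)
qed

end
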